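(* For all $n\ge0$ $$\mathbf p_{A_n}(t)=(1+t)^{\lceil n/2\rceil}\begin{cases}T_{n/2}(2t+1),&n\text{ even},\\ U_{\lfloor n/2\rfloor}(2t+1)-U_{\lfloor n/2\rfloor-1}(2t+1),&n\text{ odd},\end{cases}$$ while for $n\ge2$ $$\mathbf p_{D_{n+1}}(t)=(1+t)^{\lceil n/2\rceil+1}\begin{cases}2T_{n/2}(2t+1)-T_{n/2-1}(2t+1),&n\text{ even},\\ 2U_{\lfloor n/2\rfloor}(2t+1)-3U_{\lfloor n/2\rfloor-1}(2t+1)+U_{\lfloor n/2\rfloor-2}(2t+1),&n\text{ odd}.\end{cases}$$
   Context: $T_n(x)$ and $U_n(x)$ are the Chebyshev polynomials of the first and second kind: both satisfy $R_n(x)=2xR_{n-1}(x)-R_{n-2}(x)$, $n\ge2$, with $T_0=U_0=1$, $T_1(x)=x$, $U_1(x)=2x$; by convention $U_{-1}=0$. A Coxeter matrix over a finite set $I$ is a symmetric matrix $M=(m_{ij})_{i,j\in I}$ with $m_{ii}=1$, $m_{ij}\in\mathbb Z_{\ge2}\cup\{\infty\}$ for $i\neq j$; $W(M)$ is its Coxeter group with simple generators $s_i$. Its Coxeter graph has vertex set $I$ and an edge between $i,j$ iff $m_{ij}>2$; $J\subset I$ is connected if it is non-empty and the full subgraph on $J$ is connected. $w_\circ^J$ is the longest element of $W_J(M)=\langle s_j:j\in J\rangle$ when that group is finite. $A_n$ is the Coxeter matrix whose graph is the path $1-\cdots-n$ with all edges $m_{ij}=3$ ($A_0$ is the empty one);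 $D_{n+1}$ has all $m_{ij}\in\{2,3\}$ for $i\ne j$ and graph the path $1-\cdots-(n-1)$ with $n$ and $n+1$ both joined to $n-1$ (so $D_3=A_3$ up to relabeling). For $M$ with $W(M)$ finite let $\mathbf P_0(M)=\{1\}$ and, for $k\ge1$, $\mathbf P_k(M)=\{w_\circ^{J_1}\cdots w_\circ^{J_k}:\ J_1,\dots,J_k\subset I\text{ pairwise disjoint and connected}\}\subset W(M)$, and $\mathbf p_M(t)=\sum_{k\ge0}|\mathbf P_k(M)|t^k$. *)

theory Defs
  imports
    Complex_Main
    "HOL-Library.Extended_Nat"
    "HOL-Library.Disjoint_Sets"
    "HOL-Computational_Algebra.Polynomial"
    "HOL-Algebra.Generated_Groups"
begin

section \<open>Chebyshev polynomials\<close>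

fun cheb_T :: "nat \<Rightarrow> int poly" where
  "cheb_T 0 = 1"
| "cheb_T (Suc 0) = [:0, 1:]"
| "cheb_T (Suc (Suc n)) = 2 * [:0, 1:] * cheb_T (Suc n) - cheb_T n"

fun cheb_U_nat :: "nat \<Rightarrow> int poly" where
  "cheb_U_nat 0 = 1"
| "cheb_U_nat (Suc 0) = 2 * [:0, 1:]"
| "cheb_U_nat (Suc (Suc n)) = 2 * [:0, 1:] * cheb_U_nat (Suc n) - cheb_U_nat n"

text \<open>Integer indices accommodate the convention \<open>U\<^sub>-\<^sub>1 = 0\<close>; the value at indices below
  \<open>-1\<close> is arbitrary and never needed.\<close>

definition cheb_U :: "int \<Rightarrow> int poly" where
  "cheb_U k = (if k < 0 then 0 else cheb_U_nat (nat k))"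


section \<open>Coxeter matrices and Coxeter groups\<close>

definition coxeter_matrix :: "'i set \<Rightarrow> ('i \<Rightarrow> 'i \<Rightarrow> enat) \<Rightarrow> bool" where
  "coxeter_matrix I M \<longleftrightarrow> finite I \<and>
     (\<forall>i\<in>I. M i i = 1) \<and>
     (\<forall>i\<in>I. \<forall>j\<in>I. M i j = M j i) \<and>
     (\<forall>i\<in>I. \<forall>j\<in>I. i \<noteq> j \<longrightarrow> M i j \<ge> 2)"

text \<open>The group \<open>W(M)\<close> generated by \<open>s\<^sub>i\<close> (\<open>i \<in> I\<close>) subject to \<open>(s\<^sub>i s\<^sub>j)^(M i j) = 1\<close> whenever
  \<open>M i j\<close> is finite. Because \<open>M i i = 1\<close> makes every generator its own inverse, it is enough to take
  positive words modulo the congruence generated by the relations;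
  \<open>group_coxeter_group\<close>, \<open>coxeter_group_relation\<close>, \<open>generate_cox_gen\<close> and
  \<open>coxeter_group_universal\<close> below confirm that the result is the group so presented.\<close>

inductive cox_eq :: "'i set \<Rightarrow> ('i \<Rightarrow> 'i \<Rightarrow> enat) \<Rightarrow> 'i list \<Rightarrow> 'i list \<Rightarrow> bool"
  for I M where
  cox_refl: "u \<in> lists I \<Longrightarrow> cox_eq I M u u"
| cox_sym: "cox_eq I M u v \<Longrightarrow> cox_eq I M v u"
| cox_trans: "cox_eq I M u v \<Longrightarrow> cox_eq I M v w \<Longrightarrow> cox_eq I M u w"
| cox_rel: "u \<in> lists I \<Longrightarrow> v \<in> lists I \<Longrightarrow> i \<in> I \<Longrightarrow> j \<in> I \<Longrightarrow> M i j = enat m \<Longrightarrow>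
    cox_eq I M (u @ concat (replicate m [i, j]) @ v) (u @ v)"

definition cox_class :: "'i set \<Rightarrow> ('i \<Rightarrow> 'i \<Rightarrow> enat) \<Rightarrow> 'i list \<Rightarrow> 'i list set" where
  "cox_class I M u = {v. cox_eq I M u v}"

definition coxeter_group :: "'i set \<Rightarrow> ('i \<Rightarrow> 'i \<Rightarrow> enat) \<Rightarrow> 'i list set monoid" where
  "coxeter_group I M =
     \<lparr>carrier = cox_class I M ` lists I,
      mult = (\<lambda>A B. \<Union>a\<in>A. \<Union>b\<in>B. cox_class I M (a @ b)),
      one = cox_class I M []\<rparr>"

definition cox_gen :: "'i set \<Rightarrow> ('i \<Rightarrow> 'i \<Rightarrow> enat) \<Rightarrow> 'i \<Rightarrow> 'i list set" where
  "cox_gen I M i = cox_class I M [i]"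

text \<open>Elements of the group are classes of words, so the words in \<open>w\<close> are exactly the expressions
  of \<open>w\<close> as a product of simple generators.\<close>

definition cox_length :: "'i list set \<Rightarrow> nat" where
  "cox_length w = (LEAST k. \<exists>u\<in>w. length u = k)"

definition parabolic :: "'i set \<Rightarrow> ('i \<Rightarrow> 'i \<Rightarrow> enat) \<Rightarrow> 'i set \<Rightarrow> 'i list set set" where
  "parabolic I M J = generate (coxeter_group I M) (cox_gen I M ` J)"

text \<open>Meaningful when \<open>parabolic I M J\<close> is finite; the element of maximal length is then unique.\<close>

definition longest_element :: "'i set \<Rightarrow> ('i \<Rightarrow> 'i \<Rightarrow> enat) \<Rightarrow> 'i set \<Rightarrow> 'i list set" where
  "longest_element I M J =
     (THE w. w \<in> parabolic I M J \<and> (\<forall>v\<in>parabolic I M J. cox_length v \<le> cox_length w))"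

definition cox_connected :: "('i \<Rightarrow> 'i \<Rightarrow> enat) \<Rightarrow> 'i set \<Rightarrow> bool" where
  "cox_connected M J \<longleftrightarrow> J \<noteq> {} \<and>
     (\<forall>i\<in>J. \<forall>j\<in>J. (i, j) \<in> {(a, b). a \<in> J \<and> b \<in> J \<and> M a b > 2}\<^sup>*)"


section \<open>Products of longest elements\<close>

text \<open>For \<open>k = 0\<close> the only admissible list is empty, so \<open>P_set I M 0 = {1}\<close>.\<close>

definition P_set :: "'i set \<Rightarrow> ('i \<Rightarrow> 'i \<Rightarrow> enat) \<Rightarrow> nat \<Rightarrow> 'i list set set" where
  "P_set I M k =
     {foldr (mult (coxeter_group I M)) (map (longest_element I M) Js) (one (coxeter_group I M)) | Js.
        length Js = k \<and> (\<forall>J\<in>set Js. J \<subseteq> I \<and> cox_connected M J) \<and>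
        disjoint_family_on (nth Js) {..<k}}"

text \<open>The sum may stop at \<open>card I\<close> since \<open>k\<close> disjoint non-empty subsets of \<open>I\<close> exist only for
  \<open>k \<le> card I\<close>; see \<open>coeff_p_poly\<close>.\<close>

definition p_poly :: "'i set \<Rightarrow> ('i \<Rightarrow> 'i \<Rightarrow> enat) \<Rightarrow> int poly" where
  "p_poly I M = (\<Sum>k\<le>card I. monom (int (card (P_set I M k))) k)"


section \<open>Types A and D\<close>

text \<open>Both matrices are used on the index set \<open>{1..n}\<close>, \<open>n\<close> being the rank.\<close>

definition simply_laced :: "('i \<Rightarrow> 'i \<Rightarrow> bool) \<Rightarrow> 'i \<Rightarrow> 'i \<Rightarrow> enat" where
  "simply_laced E i j = (if i = j then 1 else if E i j \<or> E j i then 3 else 2)"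

definition matrix_A :: "nat \<Rightarrow> nat \<Rightarrow> enat" where
  "matrix_A = simply_laced (\<lambda>i j. j = i + 1)"

text \<open>The path \<open>1 - \<dots> - (n - 2)\<close> with both \<open>n - 1\<close> and \<open>n\<close> joined to \<open>n - 2\<close>.\<close>

definition matrix_D :: "nat \<Rightarrow> nat \<Rightarrow> nat \<Rightarrow> enat" where
  "matrix_D n = simply_laced (\<lambda>i j.
     (j = i + 1 \<and> j + 2 \<le> n) \<or> (i + 2 = n \<and> (j + 1 = n \<or> j = n)))"

abbreviation p_A :: "nat \<Rightarrow> int poly" where
  "p_A n \<equiv> p_poly {1..n} matrix_A"

abbreviation p_D :: "nat \<Rightarrow> int poly" where
  "p_D n \<equiv> p_poly {1..n} (matrix_D n)"


section \<open>Consistency of the definitions\<close>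

lemma coxeter_matrix_simply_laced: "finite I \<Longrightarrow> coxeter_matrix I (simply_laced E)"
  by (auto simp: coxeter_matrix_def simply_laced_def)

lemma coxeter_matrix_A: "coxeter_matrix {1..n} matrix_A"
  and coxeter_matrix_D: "coxeter_matrix {1..n} (matrix_D n)"
  by (simp_all add: matrix_A_def matrix_D_def coxeter_matrix_simply_laced)

lemma P_set_0: "P_set I M 0 = {one (coxeter_group I M)}"
  by (auto simp: P_set_def disjoint_family_on_def)

lemma P_set_empty:
  assumes "finite I" "card I < k"
  shows "P_set I M k = {}"
proof (rule ccontr)
  assume "P_set I M k \<noteq> {}"
  then obtain Js where Js: "length Js = k" "\<forall>J\<in>set Js. J \<subseteq> I \<and> cox_connected M J"
    "disjoint_family_on (nth Js) {..<k}"
    by (auto simp: P_set_def)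
  have ne: "Js ! a \<subseteq> I \<and> Js ! a \<noteq> {}" if "a < k" for a
  proof -
    have "Js ! a \<in> set Js" using that Js(1) by simp
    with Js(2) show ?thesis by (simp add: cox_connected_def)
  qed
  define f where "f a = (SOME x. x \<in> Js ! a)" for a
  have f: "f a \<in> Js ! a" if "a < k" for a
    unfolding f_def using ne[OF that] by (simp add: some_in_eq)
  have "inj_on f {..<k}"
  proof (rule inj_onI, rule ccontr)
    fix a b assume ab: "a \<in> {..<k}" "b \<in> {..<k}" "f a = f b" "a \<noteq> b"
    then have "Js ! a \<inter> Js ! b = {}"
      using Js(3) by (simp add: disjoint_family_on_def)
    with f[of a] f[of b] ab show False by auto
  qed
  moreover have "f ` {..<k} \<subseteq> I"
    using f ne by blast
  ultimately have "k \<le> card I"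
    using card_inj_on_le[of f "{..<k}" I] assms(1) by simp
  with assms(2) show False by simp
qed

lemma coeff_p_poly:
  assumes "finite I"
  shows "coeff (p_poly I M) k = int (card (P_set I M k))"
proof -
  have "coeff (p_poly I M) k =
    (\<Sum>l\<le>card I. if l = k then int (card (P_set I M l)) else 0)"
    by (simp add: p_poly_def coeff_sum)
  also have "\<dots> = int (card (P_set I M k))"
    using P_set_empty[OF assms, of k M] by (auto simp: not_le)
  finally show ?thesis .
qed

lemma cox_eq_lists: "cox_eq I M u v \<Longrightarrow> u \<in> lists I \<and> v \<in> lists I"
proof (induction rule: cox_eq.induct)
  case (cox_rel u v i j m)
  then have "set (concat (replicate m [i, j])) \<subseteq> I"
    by (induction m) auto
  with cox_rel show ?case by (auto simp: in_lists_conv_set)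
qed auto

lemma cox_eq_context:
  assumes "cox_eq I M u v" "x \<in> lists I" "y \<in> lists I"
  shows "cox_eq I M (x @ u @ y) (x @ v @ y)"
  using assms(1)
proof (induction rule: cox_eq.induct)
  case (cox_rel u v i j m)
  then show ?case
    using cox_eq.cox_rel[of "x @ u" I "v @ y" i j M m] assms(2,3) by simp
next
  case (cox_refl u)
  with assms(2,3) show ?case by (intro cox_eq.cox_refl) auto
qed (blast intro: cox_sym cox_trans)+

lemma cox_eq_append:
  assumes "cox_eq I M u u'" "cox_eq I M v v'"
  shows "cox_eq I M (u @ v) (u' @ v')"
proof (rule cox_trans)
  show "cox_eq I M (u @ v) (u' @ v)"
    using cox_eq_context[OF assms(1), of "[]" v] cox_eq_lists[OF assms(2)] by simp
  show "cox_eq I M (u' @ v) (u' @ v')"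
    using cox_eq_context[OF assms(2), of u' "[]"] cox_eq_lists[OF assms(1)] by simp
qed

lemma cox_class_eq_iff:
  assumes "u \<in> lists I"
  shows "cox_class I M u = cox_class I M v \<longleftrightarrow> cox_eq I M u v"
proof
  assume "cox_class I M u = cox_class I M v"
  moreover have "u \<in> cox_class I M u"
    using assms by (simp add: cox_class_def cox_refl)
  ultimately have "cox_eq I M v u" by (simp add: cox_class_def)
  then show "cox_eq I M u v" by (rule cox_sym)
next
  assume uv: "cox_eq I M u v"
  have "cox_eq I M u w \<longleftrightarrow> cox_eq I M v w" for w
    using cox_trans[OF uv, of w] cox_trans[OF cox_sym[OF uv], of w] by blast
  then show "cox_class I M u = cox_class I M v" by (simp add: cox_class_def)
qed

lemma coxeter_group_mult:
  assumes "u \<in> lists I" "v \<in> lists I"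
  shows "cox_class I M u \<otimes>\<^bsub>coxeter_group I M\<^esub> cox_class I M v = cox_class I M (u @ v)"
proof -
  have eq: "cox_class I M (a @ b) = cox_class I M (u @ v)"
    if "a \<in> cox_class I M u" "b \<in> cox_class I M v" for a b
  proof -
    have "cox_eq I M (u @ v) (a @ b)"
      using that by (intro cox_eq_append) (simp_all add: cox_class_def)
    then show ?thesis
      using assms cox_class_eq_iff[of "u @ v" I M "a @ b"] by simp
  qed
  have ne: "cox_class I M u \<noteq> {}" "cox_class I M v \<noteq> {}"
    using assms cox_refl[of _ I M] by (auto simp: cox_class_def)
  have "cox_class I M u \<otimes>\<^bsub>coxeter_group I M\<^esub> cox_class I M v
    = (\<Union>a\<in>cox_class I M u. \<Union>b\<in>cox_class I M v. cox_class I M (u @ v))"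
    unfolding coxeter_group_def by (simp add: eq)
  also have "\<dots> = cox_class I M (u @ v)" using ne by simp
  finally show ?thesis .
qed

lemma group_coxeter_group:
  assumes "coxeter_matrix I M"
  shows "group (coxeter_group I M)"
proof (rule groupI)
  let ?G = "coxeter_group I M"
  have car: "carrier ?G = cox_class I M ` lists I" and one: "\<one>\<^bsub>?G\<^esub> = cox_class I M []"
    by (simp_all add: coxeter_group_def)
  have repr: "\<exists>u\<in>lists I. x = cox_class I M u" if "x \<in> carrier ?G" for x
    using that by (auto simp: car)
  show "\<one>\<^bsub>?G\<^esub> \<in> carrier ?G"
    by (auto simp: car one)
  fix x assume "x \<in> carrier ?G"
  then obtain u where u: "u \<in> lists I" "x = cox_class I M u" using repr by blast
  show "\<one>\<^bsub>?G\<^esub> \<otimes>\<^bsub>?G\<^esub> x = x"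
    using u by (simp add: one coxeter_group_mult)
  have "cox_eq I M (rev u @ u) []"
    using u(1)
  proof (induction u)
    case (Cons i u)
    then have i: "i \<in> I" and "u \<in> lists I" "rev u \<in> lists I" by auto
    moreover have "M i i = enat 1"
      using assms i by (simp add: coxeter_matrix_def one_enat_def)
    ultimately have "cox_eq I M (rev u @ [i, i] @ u) (rev u @ u)"
      using cox_rel[of "rev u" I u i i M 1] by simp
    from cox_trans[OF this Cons.IH] show ?case by simp
  qed (simp add: cox_refl)
  moreover have rev_u: "rev u \<in> lists I"
    using u(1) by auto
  ultimately have "cox_class I M (rev u) \<otimes>\<^bsub>?G\<^esub> x = \<one>\<^bsub>?G\<^esub>"
    using u by (simp add: one coxeter_group_mult cox_class_eq_iff)
  then show "\<exists>y\<in>carrier ?G. y \<otimes>\<^bsub>?G\<^esub> x = \<one>\<^bsub>?G\<^esub>"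
    using rev_u unfolding car by blast
  fix y assume "y \<in> carrier ?G"
  then obtain v where v: "v \<in> lists I" "y = cox_class I M v" using repr by blast
  have uv: "u @ v \<in> lists I" using u v by simp
  show "x \<otimes>\<^bsub>?G\<^esub> y \<in> carrier ?G"
    unfolding car u(2) v(2) coxeter_group_mult[OF u(1) v(1)] using uv by blast
  fix z assume "z \<in> carrier ?G"
  then obtain w where w: "w \<in> lists I" "z = cox_class I M w" using repr by blast
  show "x \<otimes>\<^bsub>?G\<^esub> y \<otimes>\<^bsub>?G\<^esub> z = x \<otimes>\<^bsub>?G\<^esub> (y \<otimes>\<^bsub>?G\<^esub> z)"
    using u v w by (simp add: coxeter_group_mult)
qed

lemma cox_gen_closed: "i \<in> I \<Longrightarrow> cox_gen I M i \<in> carrier (coxeter_group I M)"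
  by (auto simp: cox_gen_def coxeter_group_def)

lemma coxeter_group_relation:
  assumes "coxeter_matrix I M" "i \<in> I" "j \<in> I" "M i j = enat m"
  shows "(cox_gen I M i \<otimes>\<^bsub>coxeter_group I M\<^esub> cox_gen I M j) [^]\<^bsub>coxeter_group I M\<^esub> m
    = \<one>\<^bsub>coxeter_group I M\<^esub>"
proof -
  let ?G = "coxeter_group I M"
  interpret group ?G by (rule group_coxeter_group) fact
  have one: "\<one>\<^bsub>?G\<^esub> = cox_class I M []" by (simp add: coxeter_group_def)
  have in_lists: "concat (replicate k [i, j]) \<in> lists I" for k
    using assms by (induction k) auto
  have "(cox_gen I M i \<otimes>\<^bsub>?G\<^esub> cox_gen I M j) [^]\<^bsub>?G\<^esub> k
    = cox_class I M (concat (replicate k [i, j]))" for k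
  proof (induction k)
    case (Suc k)
    have "concat (replicate k [i, j]) @ [i, j] = concat (replicate (Suc k) [i, j])"
      by (induction k) auto
    with Suc in_lists[of k] assms show ?case
      by (simp add: cox_gen_def coxeter_group_mult)
  qed (simp add: one)
  moreover have "cox_eq I M (concat (replicate m [i, j])) []"
    using cox_rel[of "[]" I "[]" i j M m] assms by simp
  ultimately show ?thesis
    using in_lists[of m] by (simp add: one cox_class_eq_iff)
qed

lemma generate_cox_gen:
  assumes "coxeter_matrix I M"
  shows "generate (coxeter_group I M) (cox_gen I M ` I) = carrier (coxeter_group I M)"
proof
  let ?G = "coxeter_group I M"
  interpret group ?G by (rule group_coxeter_group) fact
  show "generate ?G (cox_gen I M ` I) \<subseteq> carrier ?G"
    by (rule generate_incl) (auto intro: cox_gen_closed)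
  have "cox_class I M u \<in> generate ?G (cox_gen I M ` I)" if "u \<in> lists I" for u
    using that
  proof (induction u)
    case Nil
    then show ?case using generate.one[of ?G] by (simp add: coxeter_group_def)
  next
    case (Cons i u)
    then have "cox_gen I M i \<otimes>\<^bsub>?G\<^esub> cox_class I M u \<in> generate ?G (cox_gen I M ` I)"
      by (intro generate.eng) (auto intro: generate.incl)
    with Cons show ?case by (simp add: cox_gen_def coxeter_group_mult)
  qed
  then show "carrier ?G \<subseteq> generate ?G (cox_gen I M ` I)"
    by (auto simp: coxeter_group_def)
qed

lemma coxeter_group_universal:
  assumes "group H" and f: "\<And>i. i \<in> I \<Longrightarrow> f i \<in> carrier H"
    and rel: "\<And>i j m. i \<in> I \<Longrightarrow> j \<in> I \<Longrightarrow> M i j = enat m \<Longrightarrow>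
      (f i \<otimes>\<^bsub>H\<^esub> f j) [^]\<^bsub>H\<^esub> m = \<one>\<^bsub>H\<^esub>"
  shows "\<exists>h\<in>hom (coxeter_group I M) H. \<forall>i\<in>I. h (cox_gen I M i) = f i"
proof -
  let ?G = "coxeter_group I M"
  interpret H: group H by fact
  define ev where "ev u = foldr (\<lambda>i x. f i \<otimes>\<^bsub>H\<^esub> x) u \<one>\<^bsub>H\<^esub>" for u
  have ev_simps [simp]: "ev [] = \<one>\<^bsub>H\<^esub>" "ev (i # u) = f i \<otimes>\<^bsub>H\<^esub> ev u" for i u
    by (simp_all add: ev_def)
  have ev_closed [simp]: "ev u \<in> carrier H" if "u \<in> lists I" for u
    using that by (induction u) (auto simp: f)
  have ev_append: "ev (u @ v) = ev u \<otimes>\<^bsub>H\<^esub> ev v" if "u \<in> lists I" "v \<in> lists I" for u v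
    using that by (induction u) (auto simp: f H.m_assoc)
  have ev_eq: "ev u = ev v" if "cox_eq I M u v" for u v
    using that
  proof (induction rule: cox_eq.induct)
    case (cox_rel u v i j m)
    have in_lists: "concat (replicate k [i, j]) \<in> lists I" for k
      using cox_rel by (induction k) auto
    have "ev (concat (replicate k [i, j])) = (f i \<otimes>\<^bsub>H\<^esub> f j) [^]\<^bsub>H\<^esub> k" for k
    proof (induction k)
      case (Suc k)
      have fij: "f i \<in> carrier H" "f j \<in> carrier H" using cox_rel f by auto
      have "(f i \<otimes>\<^bsub>H\<^esub> f j) [^]\<^bsub>H\<^esub> Suc k
        = (f i \<otimes>\<^bsub>H\<^esub> f j) \<otimes>\<^bsub>H\<^esub> (f i \<otimes>\<^bsub>H\<^esub> f j) [^]\<^bsub>H\<^esub> k"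
        using fij by (intro H.nat_pow_Suc2) simp
      with Suc fij show ?case
        by (simp add: H.m_assoc del: nat_pow_Suc)
    qed simp
    with cox_rel in_lists[of m] rel[of i j m] show ?case
      by (simp add: ev_append)
  qed auto
  define h where "h A = ev (SOME u. u \<in> A)" for A
  have h: "h (cox_class I M u) = ev u" if "u \<in> lists I" for u
  proof -
    have "u \<in> cox_class I M u" using that by (simp add: cox_class_def cox_refl)
    then have "(SOME v. v \<in> cox_class I M u) \<in> cox_class I M u" by (rule someI)
    then show ?thesis by (auto simp: h_def cox_class_def dest: ev_eq)
  qed
  have repr: "\<exists>u\<in>lists I. x = cox_class I M u" if "x \<in> carrier ?G" for x
    using that by (auto simp: coxeter_group_def)
  have "h \<in> hom ?G H"
  proof (rule homI)
    show "h x \<in> carrier H" if "x \<in> carrier ?G" for x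
    proof -
      obtain u where "u \<in> lists I" "x = cox_class I M u"
        using repr \<open>x \<in> carrier ?G\<close> by blast
      then show ?thesis by (simp add: h)
    qed
    show "h (x \<otimes>\<^bsub>?G\<^esub> y) = h x \<otimes>\<^bsub>H\<^esub> h y" if xy: "x \<in> carrier ?G" "y \<in> carrier ?G" for x y
    proof -
      obtain u v where "u \<in> lists I" "x = cox_class I M u" "v \<in> lists I" "y = cox_class I M v"
        using repr xy by meson
      then show ?thesis by (simp add: coxeter_group_mult h ev_append)
    qed
  qed
  moreover have "h (cox_gen I M i) = f i" if "i \<in> I" for i
    using that f[OF that] by (simp add: cox_gen_def h)
  ultimately show ?thesis by blast
qed

end

(* A product of longest elements over disjoint connected sets J_1, ..., J_k records, for every edge of
   the Coxeter graph inside the union S of the J_l, whether its ends lie in the same block or which of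
   them comes first. The graph being a forest, every such labelling occurs, it determines the blocks,
   and it determines the product because non-adjacent blocks commute. Conversely the element determines
   the labelling: in the reflection representation, i and j being adjacent, the block of j strictly
   precedes that of i iff no root with positive j-coordinate is sent to a vector with negative
   i-coordinate. Hence p_M(t) is the sum over S of t^|S| (2 + 1/t)^(number of edges inside S), and adding
   leaves one at a time gives a linear recurrence for it: p_{A_{n+2}} = 2 (1+t) p_{A_{n+1}} - (1+t) p_{A_n}
   and p_{D_{n+1}} = (1+t)^2 (4 p_{A_{n-1}} - 3 p_{A_{n-2}}). *)

theory Submission imports Defs begin

text \<open>The group is given by a presentation, so words are proved equal by rewriting but told
  apart only by an action. The integral reflection representation is that action; its faithfulness
  and the sign rule for roots are proved directly for words. \<open>longest_element\<close> is a
  definite description, meaningful only once finiteness is known; this is reduced to finiteness of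
  the set of integer vectors with \<open>form x x = 2\<close>, which in types A and D is read off
  from a sum of squares. The number \<open>k\<close> of factors has to be recovered as well: it is
  the number of components left by the labelling, so configurations carry it along. The closed forms
  come from taking every second term of the recurrence in type A, which gives f(m+2) = 2 (1+t)
  (1+2t) f(m+1) - (1+t)^2 f(m): after division by (1+t)^m this is the Chebyshev recurrence at
  2t+1.\<close>

lemma card_image_cong_kernel:
  assumes "\<And>x y. x \<in> X \<Longrightarrow> y \<in> X \<Longrightarrow> f x = f y \<longleftrightarrow> g x = g y"
  shows "card (f ` X) = card (g ` X)"
proof -
  define h where "h y = g (inv_into X f y)" for y
  have h: "h (f x) = g x" if "x \<in> X" for x
    using assms[OF inv_into_into[of "f x" f X] that] f_inv_into_f[of "f x" f X] that
    by (simp add: h_def)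
  have "inj_on h (f ` X)"
    using assms h by (simp add: inj_on_def)
  moreover have "h ` f ` X = g ` X"
    using h by (simp add: image_image)
  ultimately show ?thesis using card_image by metis
qed

section \<open>The reflection representation\<close>

locale simply_laced_coxeter =
  fixes I :: "'i set" and E :: "'i \<Rightarrow> 'i \<Rightarrow> bool"
  assumes finite_I: "finite I"
begin

definition adj :: "'i \<Rightarrow> 'i \<Rightarrow> bool" where
  "adj i j \<longleftrightarrow> i \<noteq> j \<and> (E i j \<or> E j i)"

lemma adj_sym: "adj i j \<longleftrightarrow> adj j i"
  and adj_irrefl [simp]: "\<not> adj i i"
  by (auto simp: adj_def)

lemma simply_laced_adj: "simply_laced E i j = (if i = j then 1 else if adj i j then 3 else 2)"
  by (simp add: simply_laced_def adj_def)

section \<open>Rewriting words by the Coxeter relations\<close>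

abbreviation word_eq :: "'i list \<Rightarrow> 'i list \<Rightarrow> bool" (infix "\<approx>" 50) where
  "u \<approx> v \<equiv> cox_eq I (simply_laced E) u v"

lemma word_eq_trans [trans]: "u \<approx> v \<Longrightarrow> v \<approx> w \<Longrightarrow> u \<approx> w"
  by (rule cox_trans)

lemma word_eq_appendL: "u \<approx> v \<Longrightarrow> x \<in> lists I \<Longrightarrow> x @ u \<approx> x @ v"
  by (rule cox_eq_append[OF cox_refl])

lemma word_eq_appendR: "u \<approx> v \<Longrightarrow> x \<in> lists I \<Longrightarrow> u @ x \<approx> v @ x"
  by (rule cox_eq_append[OF _ cox_refl])

lemma square_eq_Nil: "i \<in> I \<Longrightarrow> [i, i] \<approx> []"
  using cox_rel[of "[]" I "[]" i i "simply_laced E" 1] by (simp add: simply_laced_adj one_enat_def)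

lemma rev_append_eq_Nil: "u \<in> lists I \<Longrightarrow> rev u @ u \<approx> []"
proof (induction u)
  case (Cons i u)
  then have "rev u \<in> lists I" by auto
  then have "rev u @ [i, i] @ u \<approx> rev u @ [] @ u"
    using Cons by (intro cox_eq_context square_eq_Nil) auto
  also have "\<dots> \<approx> []" using Cons by simp
  finally show ?case by simp
qed (simp add: cox_refl)

lemma append_rev_eq_Nil: "u \<in> lists I \<Longrightarrow> u @ rev u \<approx> []"
  using rev_append_eq_Nil[of "rev u"] by (simp add: in_lists_conv_set)

text \<open>Generators are involutions, so reversal inverts a word. Commutation and braid moves
  arise in this way from the relations with exponents 2 and 3.\<close>

lemma eq_rev_if_append_eq_Nil:
  assumes "u @ v \<approx> []"
  shows "u \<approx> rev v"
proof -
  have uv: "u \<in> lists I" "v \<in> lists I" "rev v \<in> lists I" using cox_eq_lists[OF assms] by auto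
  have "u @ v @ rev v \<approx> u @ []"
    using uv by (intro word_eq_appendL append_rev_eq_Nil)
  from cox_sym[OF this] have "u \<approx> (u @ v) @ rev v" by simp
  also have "\<dots> \<approx> [] @ rev v" using uv assms by (intro word_eq_appendR)
  finally show ?thesis by simp
qed

lemma commute_not_adj:
  assumes "i \<in> I" "j \<in> I" "\<not> adj i j"
  shows "[i, j] \<approx> [j, i]"
proof (cases "i = j")
  case False
  have "[i, j] @ [i, j] \<approx> []"
    using cox_rel[of "[]" I "[]" i j "simply_laced E" 2] assms False
    by (simp add: simply_laced_adj numeral_eq_enat eval_nat_numeral)
  from eq_rev_if_append_eq_Nil[OF this] show ?thesis by simp
qed (use assms in \<open>auto intro: cox_refl\<close>)

lemma braid_adj:
  assumes "i \<in> I" "j \<in> I" "adj i j"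
  shows "[i, j, i] \<approx> [j, i, j]"
proof -
  have "i \<noteq> j" using assms by auto
  then have "[i, j, i] @ [j, i, j] \<approx> []"
    using cox_rel[of "[]" I "[]" i j "simply_laced E" 3] assms
    by (simp add: simply_laced_adj numeral_eq_enat eval_nat_numeral)
  from eq_rev_if_append_eq_Nil[OF this] show ?thesis by simp
qed

section \<open>The integral reflection action\<close>

text \<open>The entries are -2 cos (pi / m) for m = 1, 2, 3. They are integers because the graph is
  simply laced, so all vectors can have \<open>int\<close> coordinates.\<close>

definition cartan :: "'i \<Rightarrow> 'i \<Rightarrow> int" where
  "cartan i j = (if i = j then 2 else if adj i j then -1 else 0)"

lemma cartan_sym: "cartan i j = cartan j i"
  by (auto simp: cartan_def adj_sym)

definition pairing :: "'i \<Rightarrow> ('i \<Rightarrow> int) \<Rightarrow> int" where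
  "pairing i x = (\<Sum>j\<in>I. cartan i j * x j)"

text \<open>Vectors are coordinate functions in the basis of simple roots. A reflection changes a
  single coordinate, so a word can alter only the coordinates named by its letters; this is how one
  coordinate is later followed through a long product.\<close>

definition reflect :: "'i \<Rightarrow> ('i \<Rightarrow> int) \<Rightarrow> 'i \<Rightarrow> int" where
  "reflect i x = x(i := x i - pairing i x)"

abbreviation act :: "'i list \<Rightarrow> ('i \<Rightarrow> int) \<Rightarrow> 'i \<Rightarrow> int" where
  "act \<equiv> foldr reflect"

definition simple :: "'i \<Rightarrow> 'i \<Rightarrow> int" where
  "simple s = (\<lambda>k. if k = s then 1 else 0)"

lemma pairing_upd:
  assumes "i \<in> I"
  shows "pairing j (x(i := v)) = pairing j x + cartan j i * (v - x i)"
proof -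
  have "pairing j (x(i := v)) = cartan j i * v + (\<Sum>k\<in>I - {i}. cartan j k * x k)"
    unfolding pairing_def using assms finite_I by (subst sum.remove[of I i]) (auto intro!: sum.cong)
  moreover have "pairing j x = cartan j i * x i + (\<Sum>k\<in>I - {i}. cartan j k * x k)"
    unfolding pairing_def using assms finite_I by (subst sum.remove[of I i]) auto
  ultimately show ?thesis by (simp add: algebra_simps)
qed

lemma pairing_simple: "s \<in> I \<Longrightarrow> pairing i (simple s) = cartan i s"
  using finite_I by (simp add: pairing_def simple_def if_distrib sum.delta cong: if_cong)

lemma pairing_lincomb:
  "pairing i (\<lambda>k. \<Sum>u\<in>J. a u * f u k) = (\<Sum>u\<in>J. a u * pairing i (f u))"
  by (simp add: pairing_def sum_distrib_left mult_ac sum.swap[of _ J I])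

lemma reflect_lincomb:
  "reflect i (\<lambda>k. \<Sum>u\<in>J. a u * f u k) = (\<lambda>k. \<Sum>u\<in>J. a u * reflect i (f u) k)"
  by (rule ext) (simp add: reflect_def pairing_lincomb algebra_simps sum_subtractf)

text \<open>Linearity is stated for an arbitrary index set: over simple roots it expands a vector,
  over the booleans it gives additivity, over the unit type negation.\<close>

lemma act_lincomb:
  "act w (\<lambda>k. \<Sum>u\<in>J. a u * f u k) = (\<lambda>k. \<Sum>u\<in>J. a u * act w (f u) k)"
  by (induction w) (simp_all add: reflect_lincomb)

lemma act_expand:
  assumes "finite J" "\<And>k. k \<notin> J \<Longrightarrow> x k = 0"
  shows "act w x = (\<lambda>k. \<Sum>u\<in>J. x u * act w (simple u) k)"
proof -
  have "x = (\<lambda>k. \<Sum>u\<in>J. x u * simple u k)"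
    using assms by (auto simp: simple_def if_distrib fun_eq_iff cong: if_cong)
  then show ?thesis using act_lincomb[of w x simple J] by simp
qed

lemma act_add: "act w (\<lambda>k. x k + y k) = (\<lambda>k. act w x k + act w y k)"
  using act_lincomb[of w "\<lambda>_. 1" "\<lambda>b. if b then x else y" UNIV] by (simp add: UNIV_bool add.commute)

lemma act_uminus: "act w (\<lambda>k. - x k) = (\<lambda>k. - act w x k)"
  using act_lincomb[of w "\<lambda>_. -1" "\<lambda>_. x" "{()}"] by simp

lemma reflect_reflect: "i \<in> I \<Longrightarrow> reflect i (reflect i x) = x"
  by (simp add: reflect_def pairing_upd cartan_def)

lemma act_rev_act: "u \<in> lists I \<Longrightarrow> act (rev u) (act u x) = x"
  by (induction u) (auto simp: reflect_reflect)

lemma act_act_rev: "u \<in> lists I \<Longrightarrow> act u (act (rev u) x) = x"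
  using act_rev_act[of "rev u" x] by (simp add: in_lists_conv_set)

lemma act_outside: "k \<notin> set u \<Longrightarrow> act u x k = x k"
  by (induction u) (auto simp: reflect_def)

lemma act_relation:
  assumes "i \<in> I" "j \<in> I" "simply_laced E i j = enat m"
  shows "act (concat (replicate m [i, j])) x = x"
proof -
  consider "i = j" "m = 1" | "i \<noteq> j" "adj i j" "m = 3" | "i \<noteq> j" "\<not> adj i j" "m = 2"
    using assms(3) by (auto simp: simply_laced_adj one_enat_def numeral_eq_enat split: if_splits)
  then show ?thesis
  proof cases
    case 1
    with assms show ?thesis by (simp add: reflect_reflect)
  next
    case 2
    with assms adj_sym[of i j] show ?thesis
      by (auto simp: eval_nat_numeral reflect_def pairing_upd cartan_def fun_eq_iff)
  next
    case 3
    with assms adj_sym[of i j] show ?thesis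
      by (auto simp: eval_nat_numeral reflect_def pairing_upd cartan_def fun_eq_iff)
  qed
qed

lemma act_word_eq: "u \<approx> v \<Longrightarrow> act u x = act v x"
  by (induction arbitrary: x rule: cox_eq.induct) (auto simp: act_relation)

lemma reflect_simple_same: "s \<in> I \<Longrightarrow> reflect s (simple s) = (\<lambda>k. - simple s k)"
  by (simp add: reflect_def pairing_simple cartan_def) (auto simp: simple_def)

lemma reflect_simple_adj: "s \<in> I \<Longrightarrow> adj s t \<Longrightarrow> reflect t (simple s) = (\<lambda>k. simple s k + simple t k)"
  by (simp add: reflect_def pairing_simple cartan_def adj_sym) (auto simp: simple_def)

lemma reflect_simple_not_adj: "s \<in> I \<Longrightarrow> s \<noteq> t \<Longrightarrow> \<not> adj s t \<Longrightarrow> reflect t (simple s) = simple s"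
  by (simp add: reflect_def pairing_simple cartan_def adj_sym)

section \<open>Word length and the signs of roots\<close>

text \<open>Only words over \<open>J\<close> compete, but equality is that of the whole group. Thus
  the sign arguments run inside a parabolic subgroup without comparing its length function with that
  of the whole group; for \<open>J = I\<close> this is the Coxeter length.\<close>

definition len :: "'i set \<Rightarrow> 'i list \<Rightarrow> nat" where
  "len J u = (LEAST k. \<exists>v\<in>lists J. u \<approx> v \<and> length v = k)"

lemma len_le: "v \<in> lists J \<Longrightarrow> u \<approx> v \<Longrightarrow> len J u \<le> length v"
  unfolding len_def by (rule Least_le) auto

lemma len_cong: "u \<approx> v \<Longrightarrow> len J u = len J v"
  unfolding len_def by (rule arg_cong[where f = Least]) (use cox_trans cox_sym in \<open>blast+\<close>)

lemma len_reduced: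
  assumes "u \<in> lists J" "J \<subseteq> I"
  obtains v where "v \<in> lists J" "u \<approx> v" "length v = len J u"
proof -
  have "u \<in> lists I" using assms by auto
  then have "\<exists>k. \<exists>v\<in>lists J. u \<approx> v \<and> length v = k"
    using assms cox_refl[of u I] by blast
  from LeastI_ex[OF this] show ?thesis using that unfolding len_def by blast
qed

lemma len_append_le:
  assumes "u \<in> lists J" "v \<in> lists J" "J \<subseteq> I"
  shows "len J (u @ v) \<le> len J u + length v"
proof -
  obtain u' where u': "u' \<in> lists J" "u \<approx> u'" "length u' = len J u"
    using assms(1,3) by (rule len_reduced)
  have "u @ v \<approx> u' @ v" using u' assms by (intro word_eq_appendR) auto
  from len_le[OF _ this, of J] show ?thesis using u' assms by simp
qed

lemma append_cancel:
  assumes "u \<in> lists I" "s \<in> I"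
  shows "u @ [s, s] \<approx> u"
  using word_eq_appendL[OF square_eq_Nil[OF assms(2)] assms(1)] by simp

text \<open>Induction on length, splitting off the last letter \<open>t\<close> of a shortest word
  for \<open>u\<close> and working in the dihedral group of \<open>s\<close> and \<open>t\<close>,
  of order 4 or 6. With the weak inequality as hypothesis, \<open>root_sign\<close> follows by
  merely comparing two lengths.\<close>

lemma act_simple_nonneg:
  assumes "J \<subseteq> I" "u \<in> lists J" "s \<in> J" "len J u \<le> len J (u @ [s])"
  shows "0 \<le> act u (simple s) k"
  using assms(2-)
proof (induction "len J u" arbitrary: u s k rule: less_induct)
  case less
  have sub: "w \<in> lists I" if "w \<in> lists J" for w using that assms(1) by auto
  obtain v where v: "v \<in> lists J" "u \<approx> v" "length v = len J u"
    using less.prems(1) assms(1) by (rule len_reduced)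
  show ?case
  proof (cases v rule: rev_cases)
    case Nil
    then show ?thesis using act_word_eq[OF v(2)] by (simp add: simple_def)
  next
    case (snoc v1 t)
    then have t: "t \<in> J" "t \<in> I" and v1: "v1 \<in> lists J" using v assms(1) by auto
    have s: "s \<in> J" "s \<in> I" using less.prems assms by auto
    have u: "u \<approx> v1 @ [t]" using v snoc by simp
    have len_u: "len J u = Suc (length v1)" using v snoc by simp
    have len_v1: "Suc (len J v1) = len J u"
      using len_le[OF v1 cox_refl[OF sub[OF v1]]] len_append_le[OF v1, of "[t]"] t assms(1)
        len_cong[OF u, of J] len_u by auto
    have us: "u @ [s] \<approx> v1 @ [t, s]" using word_eq_appendR[OF u, of "[s]"] s by simp
    have act_u: "act u x = act v1 (reflect t x)" for x using act_word_eq[OF u] by simp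
    have v1s: "v1 @ [s] \<in> lists J" using v1 s by simp
    have st: "s \<noteq> t"
    proof
      assume "s = t"
      then have "u @ [s] \<approx> v1" using cox_trans[OF us] append_cancel[OF sub[OF v1] s(2)] by simp
      then show False using less.prems(3) len_u len_le[OF v1, of "u @ [s]"] by simp
    qed
    show ?thesis
    proof (cases "adj s t")
      case False
      have "len J v1 \<le> len J (v1 @ [s])"
      proof (rule ccontr)
        assume *: "\<not> ?thesis"
        have "v1 @ [t, s] \<approx> v1 @ [s, t]"
          using False s t adj_sym by (intro word_eq_appendL commute_not_adj sub v1) auto
        with us have "u @ [s] \<approx> (v1 @ [s]) @ [t]" by (auto intro: cox_trans)
        then have "len J (u @ [s]) = len J ((v1 @ [s]) @ [t])" by (rule len_cong)
        also have "\<dots> \<le> len J (v1 @ [s]) + 1"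
          using len_append_le[OF v1s, of "[t]"] t assms(1) by simp
        finally show False using * less.prems(3) len_v1 by simp
      qed
      then show ?thesis
        using less.hyps[OF _ v1 s(1)] len_v1 False st s by (simp add: act_u reflect_simple_not_adj)
    next
      case True
      have split: "act u (simple s) k = act v1 (simple s) k + act v1 (simple t) k"
        using True s by (simp add: act_u reflect_simple_adj act_add)
      show ?thesis
      proof (cases "len J v1 \<le> len J (v1 @ [s])")
        case True
        then have "0 \<le> act v1 (simple s) k" using less.hyps[OF _ v1 s(1)] len_v1 by simp
        moreover have "0 \<le> act v1 (simple t) k"
          using less.hyps[OF _ v1 t(1)] len_v1 len_cong[OF u, of J] by simp
        ultimately show ?thesis using split by simp
      next
        case shorter: False
        \<comment> \<open>Now \<open>u\<close> equals \<open>v2 @ [s, t]\<close>, and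
          \<open>[s, t]\<close> sends the simple root of \<open>s\<close> to that of
          \<open>t\<close>.\<close>
        define v2 where "v2 = v1 @ [s]"
        have v2: "v2 \<in> lists J" and v1_v2: "v2 @ [s] \<approx> v1"
          using v1s append_cancel[OF sub[OF v1] s(2)] by (simp_all add: v2_def)
        have len_v2: "len J v1 = Suc (len J v2)"
          using shorter len_append_le[OF v2, of "[s]"] len_cong[OF v1_v2, of J] s assms(1)
          by (simp add: v2_def)
        have "act v1 (simple s) k = act v2 (reflect s (simple s)) k"
          using act_word_eq[OF v1_v2, of "simple s"] by simp
        moreover have "act v1 (simple t) k = act v2 (reflect s (simple t)) k"
          using act_word_eq[OF v1_v2, of "simple t"] by simp
        ultimately have act_v2: "act u (simple s) k = act v2 (simple t) k"
          using split s t True adj_sym[of s t]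
          by (simp add: reflect_simple_same reflect_simple_adj act_add act_uminus)
        \<comment> \<open>Otherwise the braid relation writes \<open>u @ [s]\<close> as
          \<open>(v2 @ [t]) @ [s, t]\<close>, which would be shorter than \<open>u\<close>.\<close>
        have "len J v2 \<le> len J (v2 @ [t])"
        proof (rule ccontr)
          assume *: "\<not> ?thesis"
          have v2t: "v2 @ [t] \<in> lists J" using v2 t by simp
          have "v1 @ [t, s] \<approx> v2 @ [s, t, s]"
            using word_eq_appendR[OF cox_sym[OF v1_v2], of "[t, s]"] s t by simp
          also have "v2 @ [s, t, s] \<approx> v2 @ [t, s, t]"
            using True s t by (intro word_eq_appendL braid_adj sub v2) auto
          finally have "u @ [s] \<approx> (v2 @ [t]) @ [s, t]" using cox_trans[OF us] by simp
          then have "len J (u @ [s]) = len J ((v2 @ [t]) @ [s, t])" by (rule len_cong)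
          also have "\<dots> \<le> len J (v2 @ [t]) + 2"
            using len_append_le[OF v2t, of "[s, t]"] s t assms(1) by simp
          finally show False using * less.prems(3) len_v1 len_v2 by simp
        qed
        then show ?thesis
          using less.hyps[OF _ v2 t(1)] len_v1 len_v2 by (simp add: act_v2)
      qed
    qed
  qed
qed

lemma act_nonpos:
  assumes "J \<subseteq> I" "u \<in> lists J" "s \<in> J" "len J (u @ [s]) \<le> len J u"
  shows "act u (simple s) k \<le> 0"
proof -
  have "len J ((u @ [s]) @ [s]) = len J u"
    using append_cancel[of u s] assms by (intro len_cong) auto
  then have "0 \<le> act (u @ [s]) (simple s) k"
    using assms by (intro act_simple_nonneg[of J]) auto
  then show ?thesis using assms by (auto simp: reflect_simple_same act_uminus)
qed

lemma root_sign:
  assumes "u \<in> lists I" "s \<in> I"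
  shows "(\<forall>k. 0 \<le> act u (simple s) k) \<or> (\<forall>k. act u (simple s) k \<le> 0)"
  using act_simple_nonneg[of I u s] act_nonpos[of I u s] assms by (meson nle_le subset_refl)

text \<open>If a shortest word over \<open>J\<close> for \<open>u\<close> were
  \<open>w @ [s]\<close>, then \<open>u\<close> would send the simple root of \<open>s\<close> to
  minus its image under \<open>w\<close>, and that image is nonnegative because \<open>w\<close> is
  not longer than \<open>w @ [s]\<close>. Being nonnegative as well, the vector would vanish,
  although words act invertibly.\<close>

lemma eq_Nil_if_nonneg:
  assumes "J \<subseteq> I" "u \<in> lists J" "\<And>s k. s \<in> J \<Longrightarrow> 0 \<le> act u (simple s) k"
  shows "u \<approx> []"
proof -
  obtain v where v: "v \<in> lists J" "u \<approx> v" "length v = len J u"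
    using assms(2,1) by (rule len_reduced)
  show ?thesis
  proof (cases v rule: rev_cases)
    case Nil
    with v show ?thesis by simp
  next
    case (snoc w s)
    then have w: "w \<in> lists J" "w \<in> lists I" and s: "s \<in> J" "s \<in> I" using v assms(1) by auto
    have "len J w \<le> length w" using w by (intro len_le cox_refl)
    also have "\<dots> \<le> len J (w @ [s])" using v snoc len_cong[OF v(2), of J] by simp
    finally have nonneg: "0 \<le> act w (simple s) k" for k
      using w s assms(1) by (intro act_simple_nonneg)
    have neg: "act u (simple s) = (\<lambda>k. - act w (simple s) k)"
      using act_word_eq[OF v(2), of "simple s"] s snoc by (simp add: reflect_simple_same act_uminus)
    have zero: "act w (simple s) = (\<lambda>k. 0)"
      using nonneg assms(3)[OF s(1)] neg by (simp add: fun_eq_iff order_antisym)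
    have "simple s = act (rev w) (\<lambda>k. 0)"
      using act_rev_act[OF w(2), of "simple s"] zero by simp
    also have "\<dots> = (\<lambda>k. 0)" using act_lincomb[of "rev w" "\<lambda>_. 0" "\<lambda>_. simple s" "{()}"] by simp
    finally show ?thesis by (simp add: simple_def fun_eq_iff split: if_splits)
  qed
qed

lemma act_faithful:
  assumes "u \<in> lists I" "v \<in> lists I" "\<And>s. s \<in> I \<Longrightarrow> act u (simple s) = act v (simple s)"
  shows "u \<approx> v"
proof -
  have "act (rev u @ v) (simple s) = simple s" if "s \<in> I" for s
    using assms(3)[OF that, symmetric] assms(1) by (simp add: act_rev_act)
  then have "rev u @ v \<approx> []"
    using assms(1,2) by (intro eq_Nil_if_nonneg[of I]) (auto simp: simple_def)
  from eq_rev_if_append_eq_Nil[OF this] have "rev u \<approx> rev v" .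
  then have "u @ rev u \<approx> u @ rev v" using assms by (intro word_eq_appendL)
  then have "u @ rev v \<approx> []"
    using append_rev_eq_Nil[OF assms(1)] cox_sym cox_trans by blast
  from eq_rev_if_append_eq_Nil[OF this] show ?thesis by simp
qed

section \<open>Longest elements\<close>

definition form :: "('i \<Rightarrow> int) \<Rightarrow> ('i \<Rightarrow> int) \<Rightarrow> int" where
  "form x y = (\<Sum>i\<in>I. x i * pairing i y)"

lemma form_sym: "form x y = form y x"
proof -
  have "form x y = (\<Sum>i\<in>I. \<Sum>j\<in>I. x i * (cartan i j * y j))"
    by (simp add: form_def pairing_def sum_distrib_left)
  also have "\<dots> = (\<Sum>j\<in>I. \<Sum>i\<in>I. x i * (cartan i j * y j))" by (rule sum.swap)
  also have "\<dots> = form y x"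
    by (simp add: form_def pairing_def sum_distrib_left mult_ac cartan_sym)
  finally show ?thesis .
qed

lemma form_simple: "s \<in> I \<Longrightarrow> form (simple s) y = pairing s y"
  using finite_I by (simp add: form_def simple_def if_distrib if_distribR sum.delta cong: if_cong)

lemma form_upd:
  assumes "i \<in> I"
  shows "form (x(i := v)) y = form x y + (v - x i) * pairing i y"
proof -
  have "form (x(i := v)) y = v * pairing i y + (\<Sum>k\<in>I - {i}. x k * pairing k y)"
    unfolding form_def using assms finite_I by (subst sum.remove[of I i]) (auto intro!: sum.cong)
  moreover have "form x y = x i * pairing i y + (\<Sum>k\<in>I - {i}. x k * pairing k y)"
    unfolding form_def using assms finite_I by (subst sum.remove[of I i]) auto
  ultimately show ?thesis by (simp add: algebra_simps)
qed

lemma form_reflect: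
  assumes "i \<in> I"
  shows "form (reflect i x) y = form x (reflect i y)"
proof -
  have "form (reflect i x) y = form x y - pairing i x * pairing i y"
    using form_upd[OF assms, of x _ y] by (simp add: reflect_def)
  moreover have "form x (reflect i y) = form y x - pairing i y * pairing i x"
    using form_upd[OF assms, of y _ x] form_sym[of x] by (simp add: reflect_def)
  ultimately show ?thesis by (simp add: form_sym[of x y] mult.commute)
qed

lemma form_act: "u \<in> lists I \<Longrightarrow> form (act u x) y = form x (act (rev u) y)"
  by (induction u arbitrary: y) (simp_all add: form_reflect)

lemma form_act_act: "u \<in> lists I \<Longrightarrow> form (act u x) (act u y) = form x y"
  by (simp add: form_act act_rev_act)

lemma carrier_eq: "carrier (coxeter_group I (simply_laced E)) = cox_class I (simply_laced E) ` lists I"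
  by (simp add: coxeter_group_def)

lemma act_simple_root:
  assumes "u \<in> lists I" "s \<in> I"
  shows "act u (simple s) \<in> {x. (\<forall>k. k \<notin> I \<longrightarrow> x k = 0) \<and> form x x = 2}"
  using assms act_outside[of _ u "simple s"]
  by (auto simp: form_act_act form_simple pairing_simple cartan_def in_lists_conv_set)
     (metis simple_def)

text \<open>\<open>generate\<close> also closes under inverses, but each generator is its own
  inverse, so positive words over \<open>J\<close> suffice.\<close>

lemma parabolic_eq:
  assumes "J \<subseteq> I"
  shows "parabolic I (simply_laced E) J = cox_class I (simply_laced E) ` lists J"
proof
  let ?G = "coxeter_group I (simply_laced E)"
  let ?c = "cox_class I (simply_laced E)"
  interpret group ?G
    by (rule group_coxeter_group) (rule coxeter_matrix_simply_laced, rule finite_I)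
  have sub: "lists J \<subseteq> lists I" using assms by auto
  have mult: "?c u \<otimes>\<^bsub>?G\<^esub> ?c v = ?c (u @ v)" if "u \<in> lists J" "v \<in> lists J" for u v
    using that sub by (intro coxeter_group_mult) auto
  have inv: "inv\<^bsub>?G\<^esub> (?c [s]) = ?c [s]" if "s \<in> J" for s
  proof (rule inv_equality)
    show "?c [s] \<otimes>\<^bsub>?G\<^esub> ?c [s] = \<one>\<^bsub>?G\<^esub>"
      using that assms square_eq_Nil[of s]
      by (simp add: subset_iff coxeter_group_mult) (simp add: coxeter_group_def cox_class_eq_iff)
  qed (use that assms in \<open>auto simp: coxeter_group_def\<close>)
  show "parabolic I (simply_laced E) J \<subseteq> ?c ` lists J"
  proof
    fix x assume "x \<in> parabolic I (simply_laced E) J"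
    then have "x \<in> generate ?G (cox_gen I (simply_laced E) ` J)" by (simp add: parabolic_def)
    then show "x \<in> ?c ` lists J"
    proof (induction rule: generate.induct)
      case one
      then show ?case by (auto simp: coxeter_group_def)
    next
      case (incl h)
      then show ?case by (auto simp: cox_gen_def)
    next
      case (inv h)
      then show ?case using \<open>\<And>s. s \<in> J \<Longrightarrow> inv\<^bsub>?G\<^esub> (?c [s]) = ?c [s]\<close> by (auto simp: cox_gen_def)
    next
      case (eng h1 h2)
      then obtain u v where "u \<in> lists J" "v \<in> lists J" "h1 = ?c u" "h2 = ?c v" by blast
      then have "h1 \<otimes>\<^bsub>?G\<^esub> h2 = ?c (u @ v)" "u @ v \<in> lists J" by (simp_all add: mult)
      then show ?case by blast
    qed
  qed
  have "?c u \<in> generate ?G (cox_gen I (simply_laced E) ` J)" if "u \<in> lists J" for u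
    using that
  proof (induction u)
    case Nil
    then show ?case using generate.one[of ?G] by (simp add: coxeter_group_def)
  next
    case (Cons i u)
    then have "cox_gen I (simply_laced E) i \<otimes>\<^bsub>?G\<^esub> ?c u \<in> generate ?G (cox_gen I (simply_laced E) ` J)"
      by (intro generate.eng) (auto intro: generate.incl)
    with Cons show ?case using mult[of "[i]" u] by (simp add: cox_gen_def)
  qed
  then show "?c ` lists J \<subseteq> parabolic I (simply_laced E) J"
    by (auto simp: parabolic_def)
qed

lemma cox_length_class:
  assumes "u \<in> lists I"
  shows "cox_length (cox_class I (simply_laced E) u) = len I u"
  unfolding cox_length_def len_def cox_class_def
  by (rule arg_cong[where f = Least]) (auto dest: cox_eq_lists)

end

text \<open>The form is invariant and simple roots have norm 2, so every root lies in the set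
  assumed finite here. This condition speaks of integer vectors only and can be verified without
  knowing the group.\<close>

locale finite_simply_laced = simply_laced_coxeter I E
  for I :: "'i set" and E :: "'i \<Rightarrow> 'i \<Rightarrow> bool" +
  assumes finite_roots: "finite {x. (\<forall>k. k \<notin> I \<longrightarrow> x k = 0) \<and> form x x = 2}"
begin

section \<open>Finiteness and longest elements\<close>

text \<open>By faithfulness an element is determined by the images of the simple roots, and each
  image lies in the finite set \<open>?R\<close>.\<close>

lemma finite_carrier: "finite (carrier (coxeter_group I (simply_laced E)))"
proof -
  let ?c = "cox_class I (simply_laced E)"
  let ?R = "{x. (\<forall>k. k \<notin> I \<longrightarrow> x k = 0) \<and> form x x = 2}"
  define f where "f w = restrict (\<lambda>s. act (SOME u. u \<in> lists I \<and> ?c u = w) (simple s)) I" for w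
  have some: "(SOME u. u \<in> lists I \<and> ?c u = w) \<in> lists I \<and> ?c (SOME u. u \<in> lists I \<and> ?c u = w) = w"
    if "w \<in> ?c ` lists I" for w
    using that by (intro someI_ex[where P = "\<lambda>u. u \<in> lists I \<and> ?c u = w"]) blast
  have "f ` ?c ` lists I \<subseteq> (I \<rightarrow>\<^sub>E ?R)"
  proof
    fix g assume "g \<in> f ` ?c ` lists I"
    then obtain w where w: "w \<in> ?c ` lists I" "g = f w" by blast
    then show "g \<in> (I \<rightarrow>\<^sub>E ?R)"
      unfolding w(2) f_def using some[OF w(1)] by (intro restrict_PiE_iff[THEN iffD2] ballI act_simple_root) auto
  qed
  moreover have "finite (I \<rightarrow>\<^sub>E ?R)"
    using finite_I finite_roots by (intro finite_PiE) auto
  ultimately have "finite (f ` ?c ` lists I)" by (rule finite_subset)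
  moreover have "inj_on f (?c ` lists I)"
  proof (rule inj_onI)
    fix w w' assume w: "w \<in> ?c ` lists I" "w' \<in> ?c ` lists I" and eq: "f w = f w'"
    from some[OF w(1)] some[OF w(2)] obtain u v
      where uv: "u = (SOME u. u \<in> lists I \<and> ?c u = w)" "v = (SOME u. u \<in> lists I \<and> ?c u = w')"
        "u \<in> lists I" "v \<in> lists I" "?c u = w" "?c v = w'" by auto
    have "act u (simple s) = act v (simple s)" if "s \<in> I" for s
      using fun_cong[OF eq, of s] that uv by (simp add: f_def)
    then have "u \<approx> v" using uv by (intro act_faithful)
    then show "w = w'" using uv cox_class_eq_iff by metis
  qed
  ultimately show ?thesis unfolding carrier_eq by (rule finite_imageD)
qed

lemma act_nonneg_comb:
  assumes "finite J" "\<And>k. k \<notin> J \<Longrightarrow> x k = 0" "\<And>k. 0 \<le> x k"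
    "\<And>s k. s \<in> J \<Longrightarrow> act u (simple s) k \<le> 0"
  shows "act u x k \<le> 0"
  using act_expand[OF assms(1,2), where w = u] assms(3,4) by (simp add: sum_nonpos mult_nonneg_nonpos)

text \<open>The image of a simple root of \<open>J\<close> under \<open>v\<close> is minus a
  nonnegative combination of simple roots of \<open>J\<close>; \<open>u\<close> makes it nonnegative
  again, so \<open>eq_Nil_if_nonneg\<close> applies to \<open>u @ v\<close>.\<close>

lemma nonpos_words_inverse:
  assumes J: "J \<subseteq> I" and "u \<in> lists J" "v \<in> lists J"
    and u: "\<And>s k. s \<in> J \<Longrightarrow> act u (simple s) k \<le> 0"
    and v: "\<And>s k. s \<in> J \<Longrightarrow> act v (simple s) k \<le> 0"
  shows "u @ v \<approx> []"
proof (rule eq_Nil_if_nonneg[OF J])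
  show "u @ v \<in> lists J" using assms by simp
  fix s k assume s: "s \<in> J"
  have "act u (\<lambda>k. - act v (simple s) k) k \<le> 0"
  proof (rule act_nonneg_comb[of J])
    show "finite J" using J finite_I by (rule finite_subset)
    show "- act v (simple s) l = 0" if "l \<notin> J" for l
      using that act_outside[of l v "simple s"] assms(3) s by (auto simp: simple_def in_lists_conv_set)
  qed (use u v s in auto)
  then show "0 \<le> act (u @ v) (simple s) k" by (simp add: act_uminus)
qed

text \<open>An element of maximal length exists by finiteness and sends the simple roots of
  \<open>J\<close> to nonpositive vectors, since \<open>u @ [s]\<close> is not longer than
  \<open>u\<close>. Any two such elements are mutually inverse, and each is its own inverse, so they
  coincide; this justifies the definite description.\<close>

lemma longest_element_word:
  assumes J: "J \<subseteq> I"
  shows "\<exists>u\<in>lists J. longest_element I (simply_laced E) J = cox_class I (simply_laced E) u \<and>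
    (\<forall>s\<in>J. \<forall>k. act u (simple s) k \<le> 0) \<and> u @ u \<approx> []"
proof -
  let ?c = "cox_class I (simply_laced E)"
  let ?P = "parabolic I (simply_laced E) J"
  have P: "?P = ?c ` lists J" using parabolic_eq[OF J] .
  have sub: "lists J \<subseteq> lists I" using J by auto
  have "finite ?P" using finite_subset[OF image_mono[OF sub] finite_carrier[unfolded carrier_eq]] by (simp add: P)
  then have "finite (cox_length ` ?P)" "cox_length ` ?P \<noteq> {}" by (auto simp: P)
  from Max_in[OF this] obtain w where w: "w \<in> ?P" "cox_length w = Max (cox_length ` ?P)" by auto
  then have max: "\<forall>v\<in>?P. cox_length v \<le> cox_length w"
    using \<open>finite (cox_length ` ?P)\<close> by simp
  have neg: "act u (simple s) k \<le> 0"
    if "u \<in> lists J" "\<forall>v\<in>?P. cox_length v \<le> cox_length (?c u)" "s \<in> J" for u s k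
  proof (rule act_nonpos[of I])
    have us: "u @ [s] \<in> lists J" using that by simp
    then have "cox_length (?c (u @ [s])) \<le> cox_length (?c u)" using that P by blast
    moreover have "u \<in> lists I" "u @ [s] \<in> lists I" using us sub that by blast+
    ultimately show "len I (u @ [s]) \<le> len I u" using cox_length_class by metis
  qed (use that sub J in auto)
  have inverse: "u @ v \<approx> []"
    if "u \<in> lists J" "\<forall>v\<in>?P. cox_length v \<le> cox_length (?c u)"
      "v \<in> lists J" "\<forall>w\<in>?P. cox_length w \<le> cox_length (?c v)" for u v
    using nonpos_words_inverse[OF J that(1,3) neg[OF that(1,2)] neg[OF that(3,4)]] .
  obtain u where u: "u \<in> lists J" "w = ?c u" using w P by auto
  have "longest_element I (simply_laced E) J = w"
    unfolding longest_element_def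
  proof (rule the_equality)
    fix w' assume w': "w' \<in> ?P \<and> (\<forall>v\<in>?P. cox_length v \<le> cox_length w')"
    then obtain v where v: "v \<in> lists J" "w' = ?c v" using P by auto
    have "u @ v \<approx> []" "v @ v \<approx> []" using inverse u v max w' by auto
    then have "u \<approx> v" using eq_rev_if_append_eq_Nil cox_sym cox_trans by meson
    moreover have "u \<in> lists I" using u sub by blast
    ultimately show "w' = w" using cox_class_eq_iff[of u I _ v] u v by metis
  qed (use w max in auto)
  moreover have "\<forall>s\<in>J. \<forall>k. act u (simple s) k \<le> 0" "u @ u \<approx> []"
    using neg[OF u(1)] inverse[OF u(1) _ u(1)] max u(2) by simp_all
  ultimately show ?thesis using u by metis
qed

definition longest_word :: "'i set \<Rightarrow> 'i list" where
  "longest_word J = (SOME u. u \<in> lists J \<and>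
     longest_element I (simply_laced E) J = cox_class I (simply_laced E) u \<and>
     (\<forall>s\<in>J. \<forall>k. act u (simple s) k \<le> 0) \<and> u @ u \<approx> [])"

lemma
  assumes "J \<subseteq> I"
  shows longest_word_lists: "longest_word J \<in> lists J"
    and longest_element_eq: "longest_element I (simply_laced E) J = cox_class I (simply_laced E) (longest_word J)"
    and longest_word_nonpos: "s \<in> J \<Longrightarrow> act (longest_word J) (simple s) k \<le> 0"
    and longest_word_square: "longest_word J @ longest_word J \<approx> []"
  using someI_ex[of "\<lambda>u. u \<in> lists J \<and>
     longest_element I (simply_laced E) J = cox_class I (simply_laced E) u \<and>
     (\<forall>s\<in>J. \<forall>k. act u (simple s) k \<le> 0) \<and> u @ u \<approx> []"] longest_element_word[OF assms]
  unfolding longest_word_def by blast+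

lemma act_longest_involution: "J \<subseteq> I \<Longrightarrow> act (longest_word J) (act (longest_word J) x) = x"
  using act_word_eq[OF longest_word_square, of J x] by simp

section \<open>Products of longest elements\<close>

definition roots :: "('i \<Rightarrow> int) set" where
  "roots = {act u (simple s) | u s. u \<in> lists I \<and> s \<in> I}"

lemma simple_root: "s \<in> I \<Longrightarrow> simple s \<in> roots"
  unfolding roots_def by (force intro!: exI[of _ "[]"])

lemma act_root:
  assumes "u \<in> lists I" "x \<in> roots"
  shows "act u x \<in> roots"
proof -
  obtain v s where "v \<in> lists I" "s \<in> I" "x = act v (simple s)"
    using assms(2) unfolding roots_def by blast
  then have "act u x = act (u @ v) (simple s)" "u @ v \<in> lists I" using assms(1) by auto
  with \<open>s \<in> I\<close> show ?thesis unfolding roots_def by blast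
qed

lemma root_nonneg:
  assumes "x \<in> roots" "0 < x k"
  shows "0 \<le> x l"
proof -
  obtain v s where "v \<in> lists I" "s \<in> I" "x = act v (simple s)"
    using assms(1) unfolding roots_def by blast
  with root_sign[of v s] assms(2) show ?thesis by (meson not_le)
qed

lemma root_outside: "x \<in> roots \<Longrightarrow> k \<notin> I \<Longrightarrow> x k = 0"
  using act_simple_root unfolding roots_def by blast

section \<open>Images of roots under longest elements\<close>

lemma pairing_nonpos:
  assumes "\<And>k. 0 \<le> x k" "x j = 0"
  shows "pairing j x \<le> 0"
  unfolding pairing_def using assms by (intro sum_nonpos) (auto simp: cartan_def)

lemma pairing_neg:
  assumes "\<And>k. 0 \<le> x k" "x j = 0" "adj i j" "i \<in> I" "0 < x i"
  shows "pairing j x < 0"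
proof -
  have "pairing j x = cartan j i * x i + (\<Sum>k\<in>I - {i}. cartan j k * x k)"
    unfolding pairing_def using assms finite_I by (subst sum.remove[of I i]) auto
  moreover have "(\<Sum>k\<in>I - {i}. cartan j k * x k) \<le> 0"
    using assms by (intro sum_nonpos) (auto simp: cartan_def)
  moreover have "cartan j i = -1" using assms(3) adj_sym[of i j] by (auto simp: cartan_def)
  ultimately show ?thesis using assms(5) by simp
qed

abbreviation conn :: "'i set \<Rightarrow> bool" where
  "conn \<equiv> cox_connected (simply_laced E)"

lemma simply_laced_gt_2: "2 < simply_laced E a b \<longleftrightarrow> adj a b"
  by (auto simp: simply_laced_adj one_enat_def numeral_eq_enat)

lemma conn_edge:
  assumes "conn J" "K \<subset> J" "K \<noteq> {}"
  shows "\<exists>a\<in>K. \<exists>b\<in>J - K. adj a b"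
proof (rule ccontr)
  assume *: "\<not> ?thesis"
  obtain a b where ab: "a \<in> K" "b \<in> J - K" using assms by blast
  then have "(a, b) \<in> {(a, b). a \<in> J \<and> b \<in> J \<and> adj a b}\<^sup>*"
    using assms unfolding cox_connected_def simply_laced_gt_2 by blast
  then have "b \<in> K" by induction (use * ab in auto)
  with ab show False by simp
qed

text \<open>The support of a nonnegative root can grow as long as it is a proper part of
  \<open>J\<close>: connectedness gives \<open>b\<close> in \<open>J\<close> outside but adjacent to
  it, the pairing there is negative, and reflecting at \<open>b\<close> makes that coordinate
  positive and changes no other.\<close>

lemma full_support_root:
  assumes "J \<subseteq> I" "conn J"
  shows "\<exists>x\<in>roots. (\<forall>k. 0 \<le> x k) \<and> (\<forall>k. 0 < x k \<longleftrightarrow> k \<in> J)"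
proof -
  let ?P = "\<lambda>K. K \<noteq> {} \<and> K \<subseteq> J \<and> (\<exists>x\<in>roots. (\<forall>k. 0 \<le> x k) \<and> (\<forall>k. 0 < x k \<longleftrightarrow> k \<in> K))"
  have fin: "finite J" using assms(1) finite_I by (rule finite_subset)
  obtain s where "s \<in> J" using assms(2) by (auto simp: cox_connected_def)
  then have "?P {s}"
    using assms(1) by (auto intro!: bexI[of _ "simple s"] simple_root simp: simple_def split: if_splits)
  moreover have "\<forall>K. ?P K \<longrightarrow> card K < Suc (card J)"
    using fin by (auto simp: less_Suc_eq_le intro: card_mono)
  ultimately have "\<exists>K. ?P K \<and> (\<forall>L. ?P L \<longrightarrow> card L \<le> card K)"
    by (rule Lattices_Big.ex_has_greatest_nat)
  then obtain K where K: "?P K" "\<And>L. ?P L \<Longrightarrow> card L \<le> card K" by (elim exE conjE) simp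
  then obtain x where x: "x \<in> roots" "\<And>k. 0 \<le> x k" "\<And>k. 0 < x k \<longleftrightarrow> k \<in> K" by blast
  have "K = J"
  proof (rule ccontr)
    assume "K \<noteq> J"
    then obtain a b where ab: "a \<in> K" "b \<in> J" "b \<notin> K" "adj a b"
      using conn_edge[OF assms(2), of K] K(1) by blast
    have xb: "x b = 0" using ab x(2,3) by (metis order_le_less)
    then have "pairing b x < 0"
      using x ab K(1) assms(1) by (intro pairing_neg[of x b a]) auto
    then have "(\<forall>k. 0 \<le> reflect b x k) \<and> (\<forall>k. 0 < reflect b x k \<longleftrightarrow> k \<in> insert b K)"
      using x xb by (auto simp: reflect_def)
    moreover have "reflect b x \<in> roots" using act_root[of "[b]" x] ab x assms(1) by auto
    ultimately have "?P (insert b K)" using K(1) ab by blast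
    then have "card (insert b K) \<le> card K" by (rule K(2))
    moreover have "finite K" using K(1) fin finite_subset by blast
    ultimately show False using ab by simp
  qed
  with x show ?thesis by blast
qed

text \<open>The image is a combination, with positive coefficients, of the nonpositive images of the
  simple roots of \<open>J\<close>. If its coordinate \<open>i\<close> vanished, then so would
  coordinate \<open>i\<close> of all these images, and hence of the simple root of \<open>i\<close>,
  which the involution reaches by acting twice.\<close>

lemma longest_full_support_neg:
  assumes J: "J \<subseteq> I" and i: "i \<in> J" and x: "\<And>k. 0 \<le> x k" "\<And>k. 0 < x k \<longleftrightarrow> k \<in> J"
  shows "act (longest_word J) x i < 0"
proof -
  let ?w = "longest_word J"
  have fin: "finite J" using J finite_I by (rule finite_subset)
  have x0: "x k = 0" if "k \<notin> J" for k using that x by (metis order_le_less)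
  have le: "x u * act ?w (simple u) i \<le> 0" if "u \<in> J" for u
    using x longest_word_nonpos[OF J that] by (simp add: mult_nonneg_nonpos)
  have sum: "act ?w x i = (\<Sum>u\<in>J. x u * act ?w (simple u) i)"
    using act_expand[OF fin x0] by simp
  have "act ?w x i \<noteq> 0"
  proof
    assume "act ?w x i = 0"
    then have "(\<Sum>u\<in>J. - (x u * act ?w (simple u) i)) = 0" using sum by (simp add: sum_negf)
    then have "x u * act ?w (simple u) i = 0" if "u \<in> J" for u
      using sum_nonneg_eq_0_iff[OF fin, of "\<lambda>u. - (x u * act ?w (simple u) i)"] le that by auto
    then have zero: "act ?w (simple u) i = 0" if "u \<in> J" for u
      using x(2)[of u] that by force
    have "act ?w (simple i) k = 0" if "k \<notin> J" for k
      using act_outside[of k ?w "simple i"] longest_word_lists[OF J] that i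
      by (auto simp: simple_def in_lists_conv_set)
    then have "act ?w (act ?w (simple i)) i = (\<Sum>u\<in>J. act ?w (simple i) u * act ?w (simple u) i)"
      using act_expand[OF fin, of "act ?w (simple i)" ?w] by simp
    then show False using act_longest_involution[OF J] zero by (simp add: simple_def)
  qed
  moreover have "act ?w x i \<le> 0" unfolding sum by (rule sum_nonpos) (rule le)
  ultimately show ?thesis by simp
qed

text \<open>The image of \<open>x\<close> is dominant for \<open>J\<close> since \<open>w\<^sub>J\<close> maps the simple roots of \<open>J\<close> to negative
  ones, and a dominant vector cannot vanish next to a positive coordinate.\<close>

lemma longest_adjacent_pos:
  assumes J: "J \<subseteq> I" and x: "x \<in> roots" "\<And>k. k \<in> J \<Longrightarrow> x k = 0" "0 < x i"
    and ij: "j \<in> J" "adj i j"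
  shows "0 < act (longest_word J) x j"
proof -
  let ?w = "longest_word J"
  have w: "?w \<in> lists J" "?w \<in> lists I" using longest_word_lists[OF J] J by auto
  have i: "i \<notin> J" "i \<in> I" using x root_outside[of x i] by auto
  have yi: "act ?w x i = x i" using w i by (intro act_outside) auto
  have nonneg: "0 \<le> act ?w x k" for k
    using root_nonneg[OF act_root[OF w(2) x(1)], of i] yi x by simp
  have xnonneg: "0 \<le> x k" for k using root_nonneg x by blast
  have "form (act ?w x) (simple j) = form (act ?w (act ?w x)) (act ?w (simple j))"
    using w by (simp add: form_act_act)
  also have "\<dots> = form (act ?w (simple j)) x"
    using act_longest_involution[OF J] form_sym by simp
  also have "\<dots> \<ge> 0" unfolding form_def
  proof (rule sum_nonneg)
    fix k assume "k \<in> I"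
    show "0 \<le> act ?w (simple j) k * pairing k x"
    proof (cases "k \<in> J")
      case True
      then show ?thesis
        using pairing_nonpos[of x k] xnonneg x longest_word_nonpos[OF J ij(1)]
        by (simp add: mult_nonpos_nonpos)
    next
      case False
      then show ?thesis
        using act_outside[of k ?w "simple j"] w ij by (auto simp: simple_def in_lists_conv_set)
    qed
  qed
  finally have "0 \<le> pairing j (act ?w x)"
    using ij J form_sym[of "act ?w x"] by (auto simp: form_simple)
  then have "act ?w x j \<noteq> 0"
    using pairing_neg[of "act ?w x" j i] nonneg ij i yi x by auto
  with nonneg[of j] show ?thesis by simp
qed

section \<open>Labellings of lists of blocks\<close>

text \<open>One relation encodes the three labels: for disjoint blocks, an edge inside the union
  whose ends share a block is one that occurs in neither direction.\<close>

fun before :: "'i set list \<Rightarrow> ('i \<times> 'i) set" where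
  "before [] = {}"
| "before (J # Js) = {(a, b). a \<in> J \<and> b \<in> \<Union> (set Js) \<and> adj a b} \<union> before Js"

lemma before_append:
  "before (A @ B) = before A \<union> {(a, b). a \<in> \<Union> (set A) \<and> b \<in> \<Union> (set B) \<and> adj a b} \<union> before B"
  by (induction A) auto

lemma before_subset:
  "(a, b) \<in> before Js \<Longrightarrow> a \<in> \<Union> (set Js) \<and> b \<in> \<Union> (set Js) \<and> adj a b"
  by (induction Js) auto

definition blocks :: "'i set list \<Rightarrow> bool" where
  "blocks Js \<longleftrightarrow> (\<forall>J\<in>set Js. J \<subseteq> I \<and> conn J) \<and> sorted_wrt disjnt Js"

lemma blocks_append_Cons:
  assumes "blocks (A @ J # B)"
  shows "J \<subseteq> I" "conn J" "\<Union> (set A) \<subseteq> I" "\<Union> (set B) \<subseteq> I"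
    "\<Union> (set A) \<inter> J = {}" "\<Union> (set B) \<inter> J = {}" "\<Union> (set A) \<inter> \<Union> (set B) = {}" "blocks (A @ B)"
proof -
  have disj: "L \<inter> K = {}" if "L \<in> set A" "K \<in> set B" for K L
    using assms that by (simp add: blocks_def sorted_wrt_append disjnt_def)
  have disjA: "L \<inter> J = {}" if "L \<in> set A" for L
    using assms that by (simp add: blocks_def sorted_wrt_append disjnt_def)
  have disjB: "K \<inter> J = {}" if "K \<in> set B" for K
    using assms that by (auto simp: blocks_def sorted_wrt_append disjnt_def)
  show "\<Union> (set A) \<inter> J = {}" "\<Union> (set B) \<inter> J = {}" using disjA disjB by blast+
  show "\<Union> (set A) \<inter> \<Union> (set B) = {}" using disj by blast
qed (use assms in \<open>auto simp: blocks_def sorted_wrt_append\<close>)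

lemma before_split:
  assumes "blocks (A @ J # B)" "i \<in> J" "adj i j"
  shows "(j, i) \<in> before (A @ J # B) \<longleftrightarrow> j \<in> \<Union> (set A)"
    and "(i, j) \<in> before (A @ J # B) \<longleftrightarrow> j \<in> \<Union> (set B)"
proof -
  have "i \<notin> \<Union> (set A)" "i \<notin> \<Union> (set B)" using blocks_append_Cons(5,6)[OF assms(1)] assms(2) by blast+
  moreover from this have "(j, i) \<notin> before A" "(j, i) \<notin> before B" "(i, j) \<notin> before A" "(i, j) \<notin> before B"
    using before_subset by blast+
  ultimately show "(j, i) \<in> before (A @ J # B) \<longleftrightarrow> j \<in> \<Union> (set A)"
    "(i, j) \<in> before (A @ J # B) \<longleftrightarrow> j \<in> \<Union> (set B)"
    using assms(2,3) adj_sym[of i j] by (auto simp: before_append)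
qed

lemma before_remove:
  assumes "blocks (A @ J # B)"
  shows "before (A @ B) = before (A @ J # B) \<inter> {(a, b). a \<notin> J \<and> b \<notin> J}"
proof -
  have notin: "a \<notin> J" if "a \<in> \<Union> (set A) \<or> a \<in> \<Union> (set B)" for a
    using blocks_append_Cons(5,6)[OF assms] that by blast
  have "(a, b) \<in> before (A @ B) \<longleftrightarrow> (a, b) \<in> before (A @ J # B) \<inter> {(a, b). a \<notin> J \<and> b \<notin> J}" for a b
  proof -
    have "(a, b) \<in> before A \<Longrightarrow> a \<notin> J \<and> b \<notin> J" "(a, b) \<in> before B \<Longrightarrow> a \<notin> J \<and> b \<notin> J"
      using before_subset notin by metis+
    then show ?thesis
      using notin[of a] notin[of b] by (auto simp: before_append simp del: Union_iff)
  qed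
  then show ?thesis by (intro equalityI subrelI) blast+
qed

definition block_word :: "'i set list \<Rightarrow> 'i list" where
  "block_word Js = concat (map longest_word Js)"

lemma block_word_simps [simp]:
  "block_word [] = []"
  "block_word (J # Js) = longest_word J @ block_word Js"
  "block_word (A @ B) = block_word A @ block_word B"
  by (simp_all add: block_word_def)

lemma block_word_lists:
  "(\<And>J. J \<in> set Js \<Longrightarrow> J \<subseteq> I) \<Longrightarrow> block_word Js \<in> lists (\<Union> (set Js))"
  by (induction Js) (use longest_word_lists in \<open>(force simp: in_lists_conv_set)+\<close>)

lemma block_word_split:
  assumes "blocks (A @ J # B)"
  shows "block_word A \<in> lists I" "set (block_word A) \<subseteq> \<Union> (set A)"
    "longest_word J \<in> lists I" "set (longest_word J) \<subseteq> J"
    "block_word B \<in> lists I" "set (block_word B) \<subseteq> \<Union> (set B)"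
proof -
  note sub = blocks_append_Cons(1,3,4)[OF assms]
  have "block_word A \<in> lists (\<Union> (set A))" "block_word B \<in> lists (\<Union> (set B))"
    using sub by (auto intro!: block_word_lists)
  then show "set (block_word A) \<subseteq> \<Union> (set A)" "set (block_word B) \<subseteq> \<Union> (set B)"
    "set (longest_word J) \<subseteq> J"
    using longest_word_lists[OF sub(1)] by (simp_all only: lists_eq_set mem_Collect_eq)
  then show "block_word A \<in> lists I" "block_word B \<in> lists I" "longest_word J \<in> lists I"
    using sub unfolding lists_eq_set by blast+
qed

section \<open>Recovering the labelling from the action\<close>

lemma mem_support_iff:
  assumes "blocks Js"
  shows "i \<in> \<Union> (set Js) \<longleftrightarrow> (\<exists>x. act (block_word Js) x i \<noteq> x i)"
proof
  assume "i \<in> \<Union> (set Js)"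
  then obtain J A B where J: "i \<in> J" "Js = A @ J # B" by (auto simp: in_set_conv_decomp)
  note b = assms[unfolded J(2)]
  \<comment> \<open>Undoing \<open>B\<close> in advance lets \<open>longest_word J\<close> act on
    the simple root itself: coordinate \<open>i\<close> is 1 in \<open>?x\<close> and nonpositive in
    its image.\<close>
  let ?x = "act (rev (block_word B)) (simple i)"
  have out: "i \<notin> \<Union> (set A)" "i \<notin> \<Union> (set B)" using blocks_append_Cons[OF b] J by blast+
  have "act (block_word Js) ?x i = act (longest_word J) (simple i) i"
    using block_word_split[OF b] out by (simp add: J(2) act_act_rev) (intro act_outside, auto)
  also have "\<dots> \<le> 0" using longest_word_nonpos blocks_append_Cons(1)[OF b] J by blast
  also have "i \<notin> set (rev (block_word B))" using block_word_split(6)[OF b] out by auto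
  then have "0 < ?x i" using act_outside[of i "rev (block_word B)" "simple i"] by (simp add: simple_def)
  finally show "\<exists>x. act (block_word Js) x i \<noteq> x i" by (metis order_less_irrefl)
next
  assume "\<exists>x. act (block_word Js) x i \<noteq> x i"
  then have "i \<in> set (block_word Js)" using act_outside by blast
  moreover have "block_word Js \<in> lists (\<Union> (set Js))"
    using assms by (intro block_word_lists) (simp add: blocks_def)
  ultimately show "i \<in> \<Union> (set Js)" by (auto simp only: in_lists_conv_set)
qed

lemma before_iff_act:
  assumes "blocks Js" "i \<in> \<Union> (set Js)" "j \<in> \<Union> (set Js)" "adj i j"
  shows "(j, i) \<in> before Js \<longleftrightarrow> \<not> (\<exists>x\<in>roots. 0 < x j \<and> act (block_word Js) x i < 0)"
proof -
  obtain J A B where J: "i \<in> J" "Js = A @ J # B" using assms(2) by (auto simp: in_set_conv_decomp)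
  note b = assms(1)[unfolded J(2)]
  note sub = blocks_append_Cons[OF b] and w = block_word_split[OF b]
  have iA: "i \<notin> \<Union> (set A)" and iB: "i \<notin> \<Union> (set B)" using sub(5,6) J(1) by blast+
  have act_i: "act (block_word Js) x i = act (longest_word J) (act (block_word B) x) i" for x
    using w(2) iA act_outside[of i "block_word A"] by (auto simp: J(2))
  have before: "(j, i) \<in> before Js \<longleftrightarrow> j \<in> \<Union> (set A)"
    using before_split(1)[OF b J(1) assms(4)] J(2) by simp
  show ?thesis
  proof (cases "j \<in> \<Union> (set A)")
    case True
    \<comment> \<open>Neither \<open>J\<close> nor \<open>B\<close> touches coordinate
      \<open>j\<close>, so the root \<open>?y\<close> is still positive there and hence nonnegative
      everywhere; \<open>A\<close> then leaves coordinate \<open>i\<close> alone.\<close>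
    have "0 \<le> act (block_word Js) x i" if "x \<in> roots" "0 < x j" for x
    proof -
      let ?y = "act (longest_word J) (act (block_word B) x)"
      have "j \<notin> set (longest_word J)" "j \<notin> set (block_word B)"
        using True w(4,6) sub(5,7) by blast+
      then have "?y j = x j" by (simp add: act_outside)
      then show ?thesis using root_nonneg[of ?y j i] that w act_i by (simp add: act_root)
    qed
    then have "\<not> (\<exists>x\<in>roots. 0 < x j \<and> act (block_word Js) x i < 0)" by (meson not_less)
    then show ?thesis using before True by simp
  next
    case notA: False
    obtain d where d: "d \<in> roots" "\<And>k. 0 \<le> d k" "\<And>k. 0 < d k \<longleftrightarrow> k \<in> J"
      using full_support_root[OF sub(1,2)] by blast
    have neg: "act (longest_word J) d i < 0"
      using sub(1) J(1) d by (intro longest_full_support_neg) auto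
    \<comment> \<open>It suffices to pull \<open>d\<close> back through \<open>B\<close> to a root
      positive at \<open>j\<close>: then \<open>longest_word J\<close> makes coordinate
      \<open>i\<close> negative, and \<open>A\<close> does not touch it.\<close>
    have "\<exists>x\<in>roots. 0 < x j \<and> act (block_word B) x = d"
    proof (cases "j \<in> J")
      case True
      let ?x = "act (rev (block_word B)) d"
      have "j \<notin> set (rev (block_word B))" using True w(6) sub(6) by auto
      then have "?x j = d j" by (rule act_outside)
      moreover have "act (block_word B) ?x = d" using w by (intro act_act_rev)
      moreover have "?x \<in> roots" using w d by (intro act_root) auto
      ultimately show ?thesis using d(3)[of j] True by (intro bexI[of _ ?x]) simp_all
    next
      case False
      with notA assms(3) J(2) obtain K where "j \<in> K" "K \<in> set B" by auto
      then obtain C D where B: "B = C @ K # D" by (auto simp: in_set_conv_decomp)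
      have b': "blocks ((A @ J # C) @ K # D)" using b B by simp
      note sub' = blocks_append_Cons[OF b'] and w' = block_word_split[OF b']
      have "L \<subseteq> I" if "L \<in> set C" for L using sub(4) B that by auto
      from block_word_lists[OF this] have C: "set (block_word C) \<subseteq> \<Union> (set C)" "block_word C \<in> lists I"
        using sub(4) B by (auto simp: in_lists_conv_set)
      \<comment> \<open>Going back through \<open>C\<close> leaves \<open>d\<close> zero on
        \<open>K\<close> and positive at the neighbour \<open>i\<close> of \<open>j\<close>. Hence
        \<open>K\<close> makes coordinate \<open>j\<close> positive, and \<open>D\<close> does not
        change it.\<close>
      define y where "y = act (rev (block_word C)) d"
      define z where "z = act (longest_word K) y"
      let ?x = "act (rev (block_word D)) z"
      have y: "y k = d k" if "k \<notin> \<Union> (set C)" for k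
        unfolding y_def using C that by (intro act_outside) auto
      have y_root: "y \<in> roots" unfolding y_def using C d by (intro act_root) auto
      have "d k = 0" if "k \<in> K" for k
        using d(2,3)[of k] sub'(5) that by (auto simp: order_le_less)
      then have "y k = 0" if "k \<in> K" for k using y[of k] sub'(5) that by auto
      moreover have "0 < y i" using y[of i] iB B J d by auto
      ultimately have "0 < z j"
        unfolding z_def using sub'(1) y_root \<open>j \<in> K\<close> assms(4) by (intro longest_adjacent_pos) auto
      moreover have "?x j = z j" using w'(6) sub'(6) \<open>j \<in> K\<close> by (intro act_outside) auto
      moreover have "?x \<in> roots"
        unfolding z_def using w' y_root by (intro act_root) auto
      moreover have "act (block_word B) ?x = d"
        using w' C act_longest_involution[OF sub'(1)] by (simp add: B act_act_rev z_def y_def)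
      ultimately show ?thesis by (intro bexI[of _ ?x]) simp_all
    qed
    then obtain x where "x \<in> roots" "0 < x j" "act (block_word B) x = d" by blast
    then have "\<exists>x\<in>roots. 0 < x j \<and> act (block_word Js) x i < 0"
      using neg act_i by (intro bexI[of _ x]) simp_all
    then show ?thesis using before notA by simp
  qed
qed

lemma block_word_eq_imp:
  assumes "blocks Js" "blocks Ks" "block_word Js \<approx> block_word Ks"
  shows "\<Union> (set Js) = \<Union> (set Ks) \<and> before Js = before Ks"
proof
  have act: "act (block_word Js) = act (block_word Ks)"
    using act_word_eq[OF assms(3)] by blast
  show un: "\<Union> (set Js) = \<Union> (set Ks)"
    by (rule Set.set_eqI) (simp only: mem_support_iff[OF assms(1)] mem_support_iff[OF assms(2)] act)
  show "before Js = before Ks"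
  proof -
    have "(a, b) \<in> before Js \<longleftrightarrow> (a, b) \<in> before Ks" for a b
    proof (cases "a \<in> \<Union> (set Js) \<and> b \<in> \<Union> (set Js) \<and> adj b a")
      case True
      then show ?thesis
        using before_iff_act[OF assms(1), of b a] before_iff_act[OF assms(2), of b a] act un by metis
    next
      case False
      then show ?thesis using before_subset[of a b] un adj_sym[of a b] by blast
    qed
    then show ?thesis by (intro equalityI subrelI) blast+
  qed
qed

section \<open>Equal labellings give equal products\<close>

lemma commute_words:
  assumes "u \<in> lists I" "v \<in> lists I" "\<And>a b. a \<in> set u \<Longrightarrow> b \<in> set v \<Longrightarrow> \<not> adj a b"
  shows "u @ v \<approx> v @ u"
proof -
  have letter: "i # v \<approx> v @ [i]" if "i \<in> I" "v \<in> lists I" "\<And>b. b \<in> set v \<Longrightarrow> \<not> adj i b" for i v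
    using that
  proof (induction v)
    case (Cons j v)
    then have "[i, j] @ v \<approx> [j, i] @ v"
      by (intro word_eq_appendR commute_not_adj) auto
    also have "[j, i] @ v \<approx> [j] @ v @ [i]"
      using word_eq_appendL[of "i # v" "v @ [i]" "[j]"] Cons by simp
    finally show ?case by simp
  qed (simp add: cox_refl)
  show ?thesis using assms
  proof (induction u)
    case (Cons i u)
    then have "[i] @ u @ v \<approx> [i] @ v @ u" by (intro word_eq_appendL) auto
    also have "(i # v) @ u \<approx> (v @ [i]) @ u"
      using Cons by (intro word_eq_appendR letter) auto
    then have "[i] @ v @ u \<approx> v @ i # u" by simp
    finally show ?case by simp
  qed (simp add: cox_refl)
qed

text \<open>A path inside \<open>J\<close> uses edges absent from \<open>before Js\<close> in both
  directions, hence absent from \<open>before Ks\<close>; its vertices lie in the union of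
  \<open>Ks\<close>, so it never leaves \<open>K\<close>. Used in both directions, this identifies
  the blocks as the components left when the oriented edges are deleted.\<close>

lemma block_subset:
  assumes "blocks Js" "blocks Ks" "\<Union> (set Js) \<subseteq> \<Union> (set Ks)" "before Ks \<subseteq> before Js"
    "J \<in> set Js" "K \<in> set Ks" "i \<in> J" "i \<in> K"
  shows "J \<subseteq> K"
proof
  fix j assume "j \<in> J"
  obtain A B where Js: "Js = A @ J # B" using assms(5) by (auto simp: in_set_conv_decomp)
  obtain C D where Ks: "Ks = C @ K # D" using assms(6) by (auto simp: in_set_conv_decomp)
  note bJ = assms(1)[unfolded Js] and bK = assms(2)[unfolded Ks]
  have "(i, j) \<in> {(a, b). a \<in> J \<and> b \<in> J \<and> adj a b}\<^sup>*"
    using blocks_append_Cons(2)[OF bJ] assms(7) \<open>j \<in> J\<close>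
    unfolding cox_connected_def simply_laced_gt_2 by blast
  then show "j \<in> K"
  proof induction
    case (step a b)
    then have ab: "a \<in> J" "b \<in> J" "adj a b" "a \<in> K" by auto
    have "b \<notin> \<Union> (set A)" "b \<notin> \<Union> (set B)" using blocks_append_Cons(5,6)[OF bJ] ab by blast+
    then have "(a, b) \<notin> before Ks" "(b, a) \<notin> before Ks"
      using before_split[OF bJ ab(1,3)] assms(4) Js by auto
    then have "b \<notin> \<Union> (set C)" "b \<notin> \<Union> (set D)"
      using before_split[OF bK ab(4,3)] Ks by auto
    then show ?case using ab assms(3,5) Ks by auto
  qed (rule assms(8))
qed

text \<open>The first block \<open>J\<close> of \<open>Js\<close> is also a block of
  \<open>Ks\<close>, preceded there by some list \<open>A\<close>. Nothing precedes \<open>J\<close>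
  in \<open>Js\<close>, so no edge joins \<open>A\<close> to \<open>J\<close>, and
  \<open>longest_word J\<close> can be moved to the front. The equality of lengths makes the number
  of factors a function of the labelling.\<close>

lemma block_word_eqI:
  assumes "blocks Js" "blocks Ks" "\<Union> (set Js) = \<Union> (set Ks)" "before Js = before Ks"
  shows "block_word Js \<approx> block_word Ks \<and> length Js = length Ks"
  using assms
proof (induction Js arbitrary: Ks)
  case Nil
  have "Ks = []"
  proof (rule ccontr)
    assume "Ks \<noteq> []"
    then have "conn (hd Ks)" "hd Ks \<in> set Ks" using Nil(2) by (auto simp: blocks_def)
    then show False using Nil(3) by (auto simp: cox_connected_def)
  qed
  then show ?case by (simp add: cox_refl)
next
  case (Cons J Js)
  have b: "blocks ([] @ J # Js)" using Cons.prems by simp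
  obtain i where i: "i \<in> J" using blocks_append_Cons(2)[OF b] by (auto simp: cox_connected_def)
  then obtain K where K: "K \<in> set Ks" "i \<in> K" using Cons.prems(3) by auto
  have "J = K"
    using block_subset[of "J # Js" Ks J K i] block_subset[of Ks "J # Js" K J i] Cons.prems i K by auto
  then obtain A B where Ks: "Ks = A @ J # B" using K by (auto simp: in_set_conv_decomp)
  note bK = Cons.prems(2)[unfolded Ks]
  note w = block_word_split[OF bK] and w0 = block_word_split[OF b]
  have "\<not> adj a c" if "a \<in> \<Union> (set A)" "c \<in> J" for a c
  proof
    assume "adj a c"
    then have "adj c a" by (simp add: adj_sym)
    then have "(a, c) \<in> before ([] @ J # Js)"
      using before_split(1)[OF bK that(2), of a] that(1) Cons.prems(4) Ks by simp
    then show False using before_split(1)[OF b that(2) \<open>adj c a\<close>] by simp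
  qed
  then have comm: "longest_word J @ block_word A \<approx> block_word A @ longest_word J"
    using w adj_sym by (intro commute_words) blast+
  have "\<Union> (set Js) = \<Union> (set (A @ B))"
  proof -
    have cancel: "X = Y" if "J \<union> X = J \<union> Y" "X \<inter> J = {}" "Y \<inter> J = {}" for X Y
      using that by blast
    show ?thesis
    proof (rule cancel)
      show "J \<union> \<Union> (set Js) = J \<union> \<Union> (set (A @ B))" using Cons.prems(3) Ks by auto
      show "\<Union> (set Js) \<inter> J = {}" by (rule blocks_append_Cons(6)[OF b])
      show "\<Union> (set (A @ B)) \<inter> J = {}"
        using blocks_append_Cons(5,6)[OF bK] by (simp add: Int_Un_distrib2)
    qed
  qed
  moreover have "before Js = before (A @ B)"
    using before_remove[OF b] before_remove[OF bK] Cons.prems(4) Ks by simp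
  moreover have "blocks Js" using blocks_append_Cons(8)[OF b] by simp
  ultimately have IH: "block_word Js \<approx> block_word (A @ B)" "length Js = length (A @ B)"
    using Cons.IH[of "A @ B"] blocks_append_Cons(8)[OF bK] by auto
  have "longest_word J @ block_word Js \<approx> longest_word J @ block_word (A @ B)"
    using w by (intro word_eq_appendL IH)
  also have "longest_word J @ block_word (A @ B) \<approx> block_word Ks"
    using word_eq_appendR[OF comm w(5)] by (simp add: Ks)
  finally show ?case using IH Ks by simp
qed

lemma block_word_lists_index:
  assumes "\<And>J. J \<in> set Js \<Longrightarrow> J \<subseteq> I"
  shows "block_word Js \<in> lists I"
proof -
  have "\<Union> (set Js) \<subseteq> I" using assms by blast
  then show ?thesis using lists_mono block_word_lists[OF assms] by blast
qed

lemma foldr_longest: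
  assumes "\<And>J. J \<in> set Js \<Longrightarrow> J \<subseteq> I"
  shows "foldr (mult (coxeter_group I (simply_laced E))) (map (longest_element I (simply_laced E)) Js)
      (one (coxeter_group I (simply_laced E))) = cox_class I (simply_laced E) (block_word Js)"
  using assms
proof (induction Js)
  case Nil
  then show ?case by (simp add: coxeter_group_def)
next
  case (Cons J Js)
  then have "block_word Js \<in> lists I" by (intro block_word_lists_index) simp
  moreover have "longest_word J \<in> lists I"
    using block_word_lists_index[of "[J]"] Cons.prems by simp
  ultimately show ?case using Cons by (simp add: longest_element_eq coxeter_group_mult)
qed

lemma disjoint_family_nth: "disjoint_family_on (nth Js) {..<length Js} \<longleftrightarrow> sorted_wrt disjnt Js"
proof
  assume "disjoint_family_on (nth Js) {..<length Js}"
  then show "sorted_wrt disjnt Js"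
    by (auto simp: disjoint_family_on_def disjnt_def sorted_wrt_iff_nth_less)
next
  assume *: "sorted_wrt disjnt Js"
  show "disjoint_family_on (nth Js) {..<length Js}"
    unfolding disjoint_family_on_def
  proof (intro ballI impI)
    fix m n assume "m \<in> {..<length Js}" "n \<in> {..<length Js}" "m \<noteq> n"
    then show "Js ! m \<inter> Js ! n = {}"
      using sorted_wrt_nth_less[OF *, of m n] sorted_wrt_nth_less[OF *, of n m]
      by (cases m n rule: linorder_cases) (auto simp: disjnt_def)
  qed
qed

lemma P_set_eq:
  "P_set I (simply_laced E) k =
    {cox_class I (simply_laced E) (block_word Js) | Js. blocks Js \<and> length Js = k}"
proof -
  have "w \<in> P_set I (simply_laced E) k \<longleftrightarrow>
    (\<exists>Js. w = cox_class I (simply_laced E) (block_word Js) \<and> blocks Js \<and> length Js = k)" for w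
    unfolding P_set_def mem_Collect_eq
    by (intro ex_cong1) (auto simp: blocks_def foldr_longest simp flip: disjoint_family_nth)
  then show ?thesis by blast
qed

text \<open>Group elements and labellings are two images of the same set of block lists, with the
  same fibres by \<open>block_word_eq_imp\<close> and \<open>block_word_eqI\<close>.\<close>

lemma card_P_set:
  "card (P_set I (simply_laced E) k) =
    card {(\<Union> (set Js), before Js) | Js. blocks Js \<and> length Js = k}"
proof -
  let ?c = "cox_class I (simply_laced E)"
  let ?X = "{Js. blocks Js \<and> length Js = k}"
  have "?c (block_word Js) = ?c (block_word Ks) \<longleftrightarrow>
    (\<Union> (set Js), before Js) = (\<Union> (set Ks), before Ks)" if "Js \<in> ?X" "Ks \<in> ?X" for Js Ks
  proof -
    have "block_word Js \<in> lists I"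
      using that by (intro block_word_lists_index) (simp add: blocks_def)
    then show ?thesis
      using that block_word_eq_imp[of Js Ks] block_word_eqI[of Js Ks] by (auto simp: cox_class_eq_iff)
  qed
  then have "card ((\<lambda>Js. ?c (block_word Js)) ` ?X) = card ((\<lambda>Js. (\<Union> (set Js), before Js)) ` ?X)"
    by (intro card_image_cong_kernel) blast
  then show ?thesis unfolding P_set_eq by (simp add: setcompr_eq_image)
qed

end

section \<open>Counting on forests\<close>

text \<open>Each vertex has at most one smaller neighbour, so every initial segment
  \<open>{1..m}\<close> ends in a leaf or an isolated vertex. This serves both the evaluation of
  \<open>form\<close> and the counting.\<close>

locale forest_coxeter = simply_laced_coxeter "{1..n}" E
  for n :: nat and E :: "nat \<Rightarrow> nat \<Rightarrow> bool" +
  fixes par :: "nat \<Rightarrow> nat"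
  assumes par_less: "1 \<le> j \<Longrightarrow> par j < j"
    and adj_iff_par: "1 \<le> i \<Longrightarrow> i < j \<Longrightarrow> j \<le> n \<Longrightarrow> adj i j \<longleftrightarrow> i = par j"
begin

text \<open>A new vertex adds twice its square and, from its single edge to a smaller vertex, minus
  twice the product with the parent. A parent 0 contributes nothing because
  \<open>x 0 = 0\<close>.\<close>

lemma form_eq_par_sum:
  assumes "\<And>k. k \<notin> {1..n} \<Longrightarrow> x k = 0"
  shows "form x x = (\<Sum>j=1..n. 2 * x j * (x j - x (par j)))"
proof -
  have "(\<Sum>i=1..m. \<Sum>j=1..m. x i * (cartan i j * x j)) = (\<Sum>j=1..m. 2 * x j * (x j - x (par j)))"
    if "m \<le> n" for m
    using that
  proof (induction m)
    case (Suc m)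
    let ?v = "Suc m"
    have "cartan i ?v * x i = (if i = par ?v then - x i else 0)" if "i \<in> {1..m}" for i
      using that Suc.prems adj_iff_par[of i ?v] by (auto simp: cartan_def)
    then have "(\<Sum>i=1..m. cartan i ?v * x i) = (\<Sum>i=1..m. if i = par ?v then - x i else 0)"
      by (intro sum.cong) auto
    also have "\<dots> = - x (par ?v)"
      using par_less[of ?v] assms[of "par ?v"] by (auto simp: sum.delta')
    finally have *: "(\<Sum>i=1..m. cartan i ?v * x i) = - x (par ?v)" .
    have **: "(\<Sum>i=1..m. x i * (cartan i ?v * x ?v)) = - x (par ?v) * x ?v"
      unfolding *[symmetric] sum_distrib_right by (intro sum.cong) (auto simp: mult_ac)
    have ***: "(\<Sum>j=1..m. x ?v * (cartan ?v j * x j)) = - x (par ?v) * x ?v"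
      unfolding *[symmetric] sum_distrib_right
      by (intro sum.cong) (auto simp: mult_ac cartan_sym[of ?v])
    show ?case
      using Suc ** *** by (simp add: sum.distrib cartan_def algebra_simps)
  qed simp
  from this[of n] show ?thesis unfolding form_def pairing_def by (simp add: sum_distrib_left)
qed

lemma finite_roots_if_bounded:
  assumes "\<And>x k. (\<And>l. l \<notin> {1..n} \<Longrightarrow> x l = 0) \<Longrightarrow> form x x = 2 \<Longrightarrow> k \<in> {1..n} \<Longrightarrow> \<bar>x k\<bar> \<le> b"
  shows "finite {x. (\<forall>k. k \<notin> {1..n} \<longrightarrow> x k = 0) \<and> form x x = 2}"
proof (rule finite_subset)
  show "{x. (\<forall>k. k \<notin> {1..n} \<longrightarrow> x k = 0) \<and> form x x = 2} \<subseteq>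
    {x. \<forall>k. (k \<in> {1..n} \<longrightarrow> x k \<in> {-b..b}) \<and> (k \<notin> {1..n} \<longrightarrow> x k = 0)}"
  proof clarify
    fix x k assume "\<forall>k. k \<notin> {1..n} \<longrightarrow> x k = 0" "form x x = 2"
    then show "(k \<in> {1..n} \<longrightarrow> x k \<in> {-b..b}) \<and> (k \<notin> {1..n} \<longrightarrow> x k = 0)"
      using assms[of x k] by auto
  qed
qed (intro finite_set_of_finite_funs finite_atLeastAtMost finite_atLeastAtMost_int)

end

text \<open>A configuration \<open>(S, R, k)\<close> consists of a set \<open>S\<close> of vertices of the forest, a relation \<open>R\<close> that
  orients some of the edges inside \<open>S\<close>, and the number \<open>k\<close> of components that remain of \<open>S\<close> when
  the oriented edges are removed. Vertices are added one by one, each one a leaf when it is added; the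
  parent \<open>0\<close> stands for no parent.\<close>

definition extend_config ::
  "'i \<Rightarrow> ('i \<times> 'i) set \<Rightarrow> nat \<Rightarrow> 'i set \<times> ('i \<times> 'i) set \<times> nat \<Rightarrow> 'i set \<times> ('i \<times> 'i) set \<times> nat" where
  "extend_config v P d = (\<lambda>(S, R, k). (insert v S, P \<union> R, k + d))"

fun configs :: "(nat \<Rightarrow> nat) \<Rightarrow> nat \<Rightarrow> (nat set \<times> (nat \<times> nat) set \<times> nat) set" where
  "configs par 0 = {({}, {}, 0)}"
| "configs par (Suc m) = configs par m
    \<union> extend_config (Suc m) {} 1 ` {c \<in> configs par m. par (Suc m) \<notin> fst c}
    \<union> extend_config (Suc m) {} 0 ` {c \<in> configs par m. par (Suc m) \<in> fst c}
    \<union> extend_config (Suc m) {(Suc m, par (Suc m))} 1 ` {c \<in> configs par m. par (Suc m) \<in> fst c}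
    \<union> extend_config (Suc m) {(par (Suc m), Suc m)} 1 ` {c \<in> configs par m. par (Suc m) \<in> fst c}"

lemma finite_configs: "finite (configs par m)"
  by (induction m) auto

lemma configs_bounds:
  "(S, R, k) \<in> configs par m \<Longrightarrow> S \<subseteq> {1..m} \<and> R \<subseteq> S \<times> S \<and> k \<le> m"
proof (induction m arbitrary: S R k)
  case (Suc m)
  have "S' \<subseteq> {1..m} \<and> R' \<subseteq> S' \<times> S' \<and> k' \<le> m" if "(S', R', k') \<in> configs par m" for S' R' k'
    using Suc.IH[OF that] .
  with Suc.prems show ?case by (fastforce simp: extend_config_def)
qed simp

lemma configs_cong:
  "(\<And>j. 1 \<le> j \<Longrightarrow> j \<le> m \<Longrightarrow> par j = par' j) \<Longrightarrow> configs par m = configs par' m"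
  by (induction m) auto

text \<open>At the last vertex \<open>R\<close> is empty or one orientation of the edge to the
  parent, so deleting that vertex leaves a smaller instance. Here \<open>k\<close> is only asserted
  to exist; \<open>blocks_config\<close> identifies it.\<close>

lemma ex_config:
  assumes par: "\<And>j. 1 \<le> j \<Longrightarrow> par j < j"
    and "S \<subseteq> {1..m}" "R \<subseteq> S \<times> S" "\<And>a b. (a, b) \<in> R \<Longrightarrow> a = par b \<or> b = par a"
    "\<And>a b. (a, b) \<in> R \<Longrightarrow> (b, a) \<notin> R"
  shows "\<exists>k. (S, R, k) \<in> configs par m"
  using assms(2-)
proof (induction m arbitrary: S R)
  case (Suc m)
  let ?v = "Suc m"
  let ?p = "par ?v"
  show ?case
  proof (cases "?v \<in> S")
    case False
    then have "S \<subseteq> {1..m}" using Suc.prems(1) by (auto simp: le_Suc_eq)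
    then show ?thesis using Suc.IH[of S R] Suc.prems by auto
  next
    case True
    let ?S = "S - {?v}"
    let ?R = "R \<inter> ?S \<times> ?S"
    have S: "?S \<subseteq> {1..m}" using Suc.prems(1) by (auto simp: le_Suc_eq)
    obtain k where k: "(?S, ?R, k) \<in> configs par m"
      using Suc.IH[OF S, of ?R] Suc.prems(2-4) by blast
    have p: "?p \<noteq> ?v" using par[of ?v] by simp
    have edge: "a = ?p" if "(a, ?v) \<in> R \<or> (?v, a) \<in> R" for a
    proof -
      have "a \<in> {1..?v}" using that Suc.prems(1,2) by blast
      then have "?v \<noteq> par a" using par[of a] by auto
      then show ?thesis using that Suc.prems(3) by blast
    qed
    have R: "R = ?R \<union> {(a, b) \<in> R. a = ?v \<or> b = ?v}" using Suc.prems(2) by blast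
    have insert: "S = insert ?v ?S" using True by blast
    consider "(?p, ?v) \<in> R" | "(?v, ?p) \<in> R" | "(?p, ?v) \<notin> R" "(?v, ?p) \<notin> R" by blast
    then show ?thesis
    proof cases
      case 1
      then have "{(a, b) \<in> R. a = ?v \<or> b = ?v} = {(?p, ?v)}"
        using edge Suc.prems(4) p by fast
      then have "(S, R, k + 1) = extend_config ?v {(?p, ?v)} 1 (?S, ?R, k)"
        using R insert by (simp add: extend_config_def Un_commute)
      moreover have "?p \<in> ?S" using 1 Suc.prems(2) p by blast
      ultimately show ?thesis using k by (force simp del: One_nat_def)
    next
      case 2
      then have "{(a, b) \<in> R. a = ?v \<or> b = ?v} = {(?v, ?p)}"
        using edge Suc.prems(4) p by fast
      then have "(S, R, k + 1) = extend_config ?v {(?v, ?p)} 1 (?S, ?R, k)"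
        using R insert by (simp add: extend_config_def Un_commute)
      moreover have "?p \<in> ?S" using 2 Suc.prems(2) p by blast
      ultimately show ?thesis using k by (force simp del: One_nat_def)
    next
      case 3
      then have "{(a, b) \<in> R. a = ?v \<or> b = ?v} = {}" using edge by blast
      with R have "?R = R" by (metis sup_bot_right)
      then have eq: "(S, R, k + d) = extend_config ?v {} d (?S, ?R, k)" for d
        by (simp add: extend_config_def insert_absorb[OF True])
      show ?thesis
      proof (cases "?p \<in> ?S")
        case True
        then have "(S, R, k + 0) \<in> extend_config ?v {} 0 ` {c \<in> configs par m. ?p \<in> fst c}"
          using k by (subst eq) (rule imageI, simp)
        then show ?thesis unfolding configs.simps by blast
      next
        case False
        then have "(S, R, k + 1) \<in> extend_config ?v {} 1 ` {c \<in> configs par m. ?p \<notin> fst c}"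
          using k by (subst eq) (rule imageI, simp)
        then show ?thesis unfolding configs.simps by blast
      qed
    qed
  qed
qed simp

text \<open>The five families differ in whether the new vertex is present, whether its parent is,
  and how their edge is oriented. Each extension is injective because the new vertex and edge can be
  removed again.\<close>

lemma sum_configs_Suc:
  fixes g :: "_ \<Rightarrow> 'b :: comm_monoid_add"
  assumes "\<And>j. 1 \<le> j \<Longrightarrow> par j < j"
  shows "sum g (configs par (Suc m)) = (\<Sum>c\<in>configs par m. g c)
    + (\<Sum>c | c \<in> configs par m \<and> par (Suc m) \<notin> fst c. g (extend_config (Suc m) {} 1 c))
    + (\<Sum>c | c \<in> configs par m \<and> par (Suc m) \<in> fst c. g (extend_config (Suc m) {} 0 c))
    + (\<Sum>c | c \<in> configs par m \<and> par (Suc m) \<in> fst c. g (extend_config (Suc m) {(Suc m, par (Suc m))} 1 c))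
    + (\<Sum>c | c \<in> configs par m \<and> par (Suc m) \<in> fst c. g (extend_config (Suc m) {(par (Suc m), Suc m)} 1 c))"
proof -
  let ?v = "Suc m"
  let ?p = "par ?v"
  let ?C = "configs par m"
  have p: "?p \<noteq> ?v" using assms[of ?v] by simp
  have v: "?v \<notin> S" "(?v, a) \<notin> R" "(a, ?v) \<notin> R" if "(S, R, k) \<in> ?C" for S R k a
    using configs_bounds[OF that] by auto
  have inj: "inj_on (extend_config ?v P d) X" if "X \<subseteq> ?C" "P \<subseteq> {(?v, ?p), (?p, ?v)}" for P d X
  proof (rule inj_onI)
    fix c c' assume *: "c \<in> X" "c' \<in> X" "extend_config ?v P d c = extend_config ?v P d c'"
    obtain S R k S' R' k' where c: "c = (S, R, k)" "c' = (S', R', k')" by (metis surj_pair)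
    note eq = *(3)[unfolded c]
    have X: "(S, R, k) \<in> ?C" "(S', R', k') \<in> ?C" using * that(1) c by blast+
    have "S = S'" using eq v(1)[OF X(1)] v(1)[OF X(2)] by (simp add: extend_config_def insert_ident)
    have "P \<inter> R = {}" "P \<inter> R' = {}" using v[OF X(1)] v[OF X(2)] that(2) by blast+
    moreover have "P \<union> R = P \<union> R'" using eq by (simp add: extend_config_def)
    ultimately have "R = R'" by blast
    with \<open>S = S'\<close> show "c = c'" using eq c by (simp add: extend_config_def)
  qed
  let ?A1 = "extend_config ?v {} 1 ` {c \<in> ?C. ?p \<notin> fst c}"
  let ?A2 = "extend_config ?v {} 0 ` {c \<in> ?C. ?p \<in> fst c}"
  let ?A3 = "extend_config ?v {(?v, ?p)} 1 ` {c \<in> ?C. ?p \<in> fst c}"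
  let ?A4 = "extend_config ?v {(?p, ?v)} 1 ` {c \<in> ?C. ?p \<in> fst c}"
  have d1: "?C \<inter> ?A1 = {}" and d2: "(?C \<union> ?A1) \<inter> ?A2 = {}"
    using v p by (auto simp: extend_config_def insert_ident)
  have "(?v, ?p) \<notin> fst (snd c)" "(?p, ?v) \<notin> fst (snd c)" if "c \<in> ?C \<union> ?A1 \<union> ?A2" for c
    using that v by (cases c; auto simp: extend_config_def)+
  moreover have "(?v, ?p) \<in> fst (snd c)" "(?p, ?v) \<notin> fst (snd c)" if "c \<in> ?A3" for c
    using that v p by (auto simp: extend_config_def)
  moreover have "(?p, ?v) \<in> fst (snd c)" if "c \<in> ?A4" for c
    using that by (auto simp: extend_config_def)
  ultimately have d3: "(?C \<union> ?A1 \<union> ?A2) \<inter> ?A3 = {}" and d4: "(?C \<union> ?A1 \<union> ?A2 \<union> ?A3) \<inter> ?A4 = {}"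
    by blast+
  have fin: "finite ?C" "finite ?A1" "finite ?A2" "finite ?A3" "finite ?A4"
    using finite_configs[of par m] by auto
  have "sum g (configs par (Suc m)) = sum g ?C + sum g ?A1 + sum g ?A2 + sum g ?A3 + sum g ?A4"
    unfolding configs.simps using fin d1 d2 d3 d4 by (simp add: sum.union_disjoint)
  then show ?thesis by (simp add: sum.reindex inj)
qed

section \<open>The generating polynomial of configurations\<close>

text \<open>The filter \<open>Q\<close> allows recording whether the vertex to which the next leaf
  is attached is present, which is all that a recurrence has to remember.\<close>

definition config_poly :: "(nat \<Rightarrow> nat) \<Rightarrow> nat \<Rightarrow> (nat set \<Rightarrow> bool) \<Rightarrow> int poly" where
  "config_poly par m Q = (\<Sum>c\<in>configs par m. if Q (fst c) then monom 1 (snd (snd c)) else 0)"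

lemma config_poly_cong:
  assumes "\<And>S. S \<subseteq> {1..m} \<Longrightarrow> Q S \<longleftrightarrow> Q' S"
  shows "config_poly par m Q = config_poly par m Q'"
  unfolding config_poly_def
proof (rule sum.cong, goal_cases)
  case (2 c)
  then have "fst c \<subseteq> {1..m}" using configs_bounds[of "fst c" "fst (snd c)" "snd (snd c)"] by simp
  then show ?case using assms by simp
qed simp

lemma config_poly_split:
  "config_poly par m (\<lambda>S. P S \<and> Q S) + config_poly par m (\<lambda>S. \<not> P S \<and> Q S) = config_poly par m Q"
  unfolding config_poly_def sum.distrib[symmetric] by (rule sum.cong) auto

text \<open>A vertex with absent parent opens a component and has weight t. With the parent present
  it joins its block, with weight 1, or is separated from it in either of two orders, with weight t
  each: together 1 + 2t.\<close>

lemma config_poly_Suc: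
  assumes "\<And>j. 1 \<le> j \<Longrightarrow> par j < j"
  shows "config_poly par (Suc m) Q = config_poly par m Q
    + [:0, 1:] * config_poly par m (\<lambda>S. par (Suc m) \<notin> S \<and> Q (insert (Suc m) S))
    + [:1, 2:] * config_poly par m (\<lambda>S. par (Suc m) \<in> S \<and> Q (insert (Suc m) S))"
proof -
  let ?v = "Suc m"
  let ?p = "par ?v"
  let ?C = "configs par m"
  let ?in = "config_poly par m (\<lambda>S. ?p \<in> S \<and> Q (insert ?v S))"
  let ?out = "config_poly par m (\<lambda>S. ?p \<notin> S \<and> Q (insert ?v S))"
  let ?g = "\<lambda>c. if Q (fst c) then monom 1 (snd (snd c)) else (0 :: int poly)"
  have part: "(\<Sum>c | c \<in> ?C \<and> B (fst c). ?g (extend_config ?v P d c)) =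
    monom 1 d * config_poly par m (\<lambda>S. B S \<and> Q (insert ?v S))" for B P d
  proof -
    have "(\<Sum>c | c \<in> ?C \<and> B (fst c). ?g (extend_config ?v P d c)) =
      (\<Sum>c | c \<in> ?C \<and> B (fst c). if Q (insert ?v (fst c)) then monom 1 (snd (snd c) + d) else 0)"
      by (rule sum.cong) (auto simp: extend_config_def split_beta)
    also have "\<dots> = (\<Sum>c\<in>?C. if B (fst c) then
      (if Q (insert ?v (fst c)) then monom 1 (snd (snd c) + d) else 0) else 0)"
      by (rule sum.inter_filter[OF finite_configs])
    also have "\<dots> = monom 1 d * config_poly par m (\<lambda>S. B S \<and> Q (insert ?v S))"
      unfolding config_poly_def sum_distrib_left by (rule sum.cong) (auto simp: mult_monom add.commute)
    finally show ?thesis .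
  qed
  have "config_poly par ?v Q = sum ?g (configs par ?v)" by (simp only: config_poly_def)
  also have "\<dots> = sum ?g ?C
    + (\<Sum>c | c \<in> ?C \<and> ?p \<notin> fst c. ?g (extend_config ?v {} 1 c))
    + (\<Sum>c | c \<in> ?C \<and> ?p \<in> fst c. ?g (extend_config ?v {} 0 c))
    + (\<Sum>c | c \<in> ?C \<and> ?p \<in> fst c. ?g (extend_config ?v {(?v, ?p)} 1 c))
    + (\<Sum>c | c \<in> ?C \<and> ?p \<in> fst c. ?g (extend_config ?v {(?p, ?v)} 1 c))"
    by (rule sum_configs_Suc) (rule assms)
  also have "\<dots> = config_poly par m Q + monom 1 1 * ?out + monom 1 0 * ?in + monom 1 1 * ?in + monom 1 1 * ?in"
  proof -
    have "(\<Sum>c | c \<in> ?C \<and> ?p \<notin> fst c. ?g (extend_config ?v {} 1 c)) = monom 1 1 * ?out" by (rule part)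
    moreover have "(\<Sum>c | c \<in> ?C \<and> ?p \<in> fst c. ?g (extend_config ?v P d c)) = monom 1 d * ?in" for P d
      by (rule part)
    ultimately show ?thesis by (simp only: config_poly_def[of par m Q])
  qed
  also have "\<dots> = config_poly par m Q + [:0, 1:] * ?out + [:1, 2:] * ?in"
    by (simp add: monom_Suc algebra_simps numeral_poly flip: one_pCons)
  finally show ?thesis .
qed

text \<open>Keeps the index set \<open>{1..n}\<close> from being rewritten to \<open>{Suc 0..n}\<close>.\<close>

declare One_nat_def [simp del]

locale finite_forest = forest_coxeter n E par + finite_simply_laced "{1..n}" E
  for n :: nat and E :: "nat \<Rightarrow> nat \<Rightarrow> bool" and par :: "nat \<Rightarrow> nat"
begin

section \<open>Configurations realized by lists of blocks\<close>

text \<open>A singleton block at the front or at the end of the list realizes the two orientations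
  of the new edge.\<close>

lemma blocks_insert_leaf:
  assumes Js: "blocks Js" "\<Union> (set Js) \<subseteq> {1..m}" and v: "Suc m \<le> n"
  shows "blocks ({Suc m} # Js) \<and> before ({Suc m} # Js) =
      (if par (Suc m) \<in> \<Union> (set Js) then {(Suc m, par (Suc m))} else {}) \<union> before Js"
    and "blocks (Js @ [{Suc m}]) \<and> before (Js @ [{Suc m}]) =
      (if par (Suc m) \<in> \<Union> (set Js) then {(par (Suc m), Suc m)} else {}) \<union> before Js"
proof -
  let ?v = "Suc m"
  have notin: "?v \<notin> J" if "J \<in> set Js" for J using Js(2) that by fastforce
  have conn: "conn {?v}" by (simp add: cox_connected_def)
  have adj: "adj a ?v \<longleftrightarrow> a = par ?v" if "a \<in> J" "J \<in> set Js" for a J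
  proof -
    have "a \<in> {1..m}" using that Js(2) by blast
    then show ?thesis using v by (intro adj_iff_par) auto
  qed
  show "blocks ({?v} # Js) \<and> before ({?v} # Js) =
      (if par ?v \<in> \<Union> (set Js) then {(?v, par ?v)} else {}) \<union> before Js"
    using Js(1) notin conn v adj adj_sym[of ?v] by (auto simp: blocks_def disjnt_def)
  show "blocks (Js @ [{?v}]) \<and> before (Js @ [{?v}]) =
      (if par ?v \<in> \<Union> (set Js) then {(par ?v, ?v)} else {}) \<union> before Js"
    using Js(1) notin conn v adj
    by (auto simp: blocks_def disjnt_def sorted_wrt_append before_append)
qed

lemma conn_insert:
  assumes "conn J" "p \<in> J" "adj p v"
  shows "conn (insert v J)"
proof -
  let ?r = "{(a, b). a \<in> insert v J \<and> b \<in> insert v J \<and> adj a b}"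
  have "{(a, b). a \<in> J \<and> b \<in> J \<and> adj a b} \<subseteq> ?r" by blast
  from rtrancl_mono[OF this] have J: "(a, b) \<in> ?r\<^sup>*" if "a \<in> J" "b \<in> J" for a b
    using assms(1) that unfolding cox_connected_def simply_laced_gt_2 by blast
  have pv: "(p, v) \<in> ?r\<^sup>*" "(v, p) \<in> ?r\<^sup>*" using assms(2,3) adj_sym by auto
  have to_p: "(a, p) \<in> ?r\<^sup>*" "(p, a) \<in> ?r\<^sup>*" if "a \<in> insert v J" for a
    using that pv J assms(2) by auto
  show ?thesis
    unfolding cox_connected_def simply_laced_gt_2
    by (intro conjI ballI insert_not_empty rtrancl_trans[OF to_p(1) to_p(2)])
qed

text \<open>This realizes the unoriented new edge: the parent is the only neighbour of the new
  vertex among the smaller ones, so no edge to another block arises.\<close>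

lemma blocks_enlarge:
  assumes b: "blocks (A @ J # B)" and sub: "\<Union> (set (A @ J # B)) \<subseteq> {1..m}"
    and v: "Suc m \<le> n" and p: "par (Suc m) \<in> J"
  shows "blocks (A @ insert (Suc m) J # B)"
    and "before (A @ insert (Suc m) J # B) = before (A @ J # B)"
proof -
  let ?v = "Suc m"
  have adj: "adj a ?v \<longleftrightarrow> a = par ?v" "adj ?v a \<longleftrightarrow> a = par ?v" if "a \<in> \<Union> (set (A @ J # B))" for a
  proof -
    have "a \<in> {1..m}" using that sub by blast
    then show "adj a ?v \<longleftrightarrow> a = par ?v" using v by (intro adj_iff_par) auto
    then show "adj ?v a \<longleftrightarrow> a = par ?v" by (simp add: adj_sym)
  qed
  have "adj (par ?v) ?v" using adj(1)[of "par ?v"] p by simp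
  then have "conn (insert ?v J)" using conn_insert[OF blocks_append_Cons(2)[OF b] p] by simp
  moreover have "?v \<notin> K" if "K \<in> set A \<union> set B" for K using sub that by fastforce
  ultimately show "blocks (A @ insert ?v J # B)"
    using b v by (auto simp: blocks_def sorted_wrt_append disjnt_def)
  have "par ?v \<notin> \<Union> (set A)" "par ?v \<notin> \<Union> (set B)"
    using blocks_append_Cons(5,6)[OF b] p by blast+
  then have "\<not> adj a ?v \<and> \<not> adj ?v a" if "a \<in> K" "K \<in> set A \<union> set B" for a K
    using adj[of a] that by auto
  then show "before (A @ insert ?v J # B) = before (A @ J # B)"
    by (auto simp: before_append)
qed

lemma config_realized:
  assumes "(S, R, k) \<in> configs par m" "m \<le> n"
  shows "\<exists>Js. blocks Js \<and> \<Union> (set Js) = S \<and> before Js = R \<and> length Js = k"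
  using assms
proof (induction m arbitrary: S R k)
  case 0
  then show ?case by (intro exI[of _ "[]"]) (simp add: blocks_def)
next
  case (Suc m)
  let ?v = "Suc m"
  let ?p = "par ?v"
  have IH: "\<exists>Js. blocks Js \<and> \<Union> (set Js) = S' \<and> before Js = R' \<and> length Js = k' \<and> S' \<subseteq> {1..m}"
    if "(S', R', k') \<in> configs par m" for S' R' k'
    using Suc.IH[OF that] Suc.prems(2) configs_bounds[OF that] by simp
  show ?case
  proof (cases "(S, R, k) \<in> configs par m")
    case True
    then show ?thesis using IH by blast
  next
    case False
    then obtain S' R' k' P d where C: "(S', R', k') \<in> configs par m"
      and ext: "(S, R, k) = extend_config ?v P d (S', R', k')"
      and cases: "?p \<notin> S' \<and> P = {} \<and> d = 1 \<or> ?p \<in> S' \<and> P = {} \<and> d = 0 \<or>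
        ?p \<in> S' \<and> P = {(?v, ?p)} \<and> d = 1 \<or> ?p \<in> S' \<and> P = {(?p, ?v)} \<and> d = 1"
      using Suc.prems(1) by (auto simp del: One_nat_def)
    obtain Js where Js: "blocks Js" "\<Union> (set Js) = S'" "before Js = R'" "length Js = k'" "S' \<subseteq> {1..m}"
      using IH[OF C] by blast
    note leaf = blocks_insert_leaf[OF Js(1) Js(5)[folded Js(2)] Suc.prems(2)]
    from cases consider "?p \<notin> S'" "P = {}" "d = 1" | "?p \<in> S'" "P = {}" "d = 0"
      | "?p \<in> S'" "P = {(?v, ?p)}" "d = 1" | "?p \<in> S'" "P = {(?p, ?v)}" "d = 1" by blast
    then show ?thesis
    proof cases
      case 1
      then show ?thesis using leaf(1) Js ext
        by (intro exI[of _ "{?v} # Js"]) (simp add: extend_config_def)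
    next
      case 2
      then obtain J A B where J: "?p \<in> J" "Js = A @ J # B" using Js(2) by (auto simp: in_set_conv_decomp)
      then have "blocks (A @ J # B)" "\<Union> (set (A @ J # B)) \<subseteq> {1..m}" using Js(1,2,5) by (simp_all only:)
      note blocks_enlarge[OF this Suc.prems(2) J(1)]
      then show ?thesis
        using J(2) Js ext 2
        by (intro exI[of _ "A @ insert ?v J # B"]) (simp add: extend_config_def)
    next
      case 3
      then show ?thesis using leaf(1) Js ext
        by (intro exI[of _ "{?v} # Js"]) (simp add: extend_config_def)
    next
      case 4
      then show ?thesis using leaf(2) Js ext
        by (intro exI[of _ "Js @ [{?v}]"]) (simp add: extend_config_def)
    qed
  qed
qed

text \<open>\<open>ex_config\<close> yields the right vertices and orientation with an unknown
  \<open>k\<close>. Realizing that configuration by blocks and comparing through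
  \<open>block_word_eqI\<close> forces \<open>k = length Js\<close>.\<close>

lemma blocks_config:
  assumes "blocks Js"
  shows "(\<Union> (set Js), before Js, length Js) \<in> configs par n"
proof -
  have sub: "\<Union> (set Js) \<subseteq> {1..n}" using assms by (auto simp: blocks_def)
  have "\<exists>k. (\<Union> (set Js), before Js, k) \<in> configs par n"
  proof (rule ex_config[OF par_less sub])
    show "before Js \<subseteq> \<Union> (set Js) \<times> \<Union> (set Js)" using before_subset by fast
    fix a b assume ab: "(a, b) \<in> before Js"
    then have mem: "a \<in> \<Union> (set Js)" "b \<in> \<Union> (set Js)" "adj a b" using before_subset by blast+
    then have "a \<noteq> b" "1 \<le> a" "1 \<le> b" "a \<le> n" "b \<le> n" using sub by auto
    then show "a = par b \<or> b = par a"
      using mem(3) adj_iff_par[of a b] adj_iff_par[of b a] adj_sym[of a b] by (auto simp: linorder_neq_iff)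
    obtain J A B where J: "a \<in> J" "Js = A @ J # B" using mem(1) by (auto simp: in_set_conv_decomp)
    note b = assms[unfolded J(2)]
    show "(b, a) \<notin> before Js"
      using before_split[OF b J(1) mem(3)] ab J(2) blocks_append_Cons(7)[OF b] by blast
  qed
  then obtain k where k: "(\<Union> (set Js), before Js, k) \<in> configs par n" by blast
  from config_realized[OF this] obtain Ks where
    "blocks Ks" "\<Union> (set Ks) = \<Union> (set Js)" "before Ks = before Js" "length Ks = k" by auto
  then have "length Js = k" using block_word_eqI[OF assms, of Ks] by simp
  with k show ?thesis by simp
qed

lemma p_poly_eq_config_poly: "p_poly {1..n} (simply_laced E) = config_poly par n (\<lambda>_. True)"
proof -
  have "card (P_set {1..n} (simply_laced E) k) = card {c \<in> configs par n. snd (snd c) = k}" for k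
  proof -
    have "{(\<Union> (set Js), before Js) | Js. blocks Js \<and> length Js = k} =
      (\<lambda>c. (fst c, fst (snd c))) ` {c \<in> configs par n. snd (snd c) = k}"
      (is "?L = ?R")
    proof
      show "?L \<subseteq> ?R"
      proof
        fix x assume "x \<in> ?L"
        then obtain Js where "blocks Js" "length Js = k" "x = (\<Union> (set Js), before Js)" by blast
        then show "x \<in> ?R"
          using blocks_config[of Js] by (intro image_eqI[of _ _ "(\<Union> (set Js), before Js, k)"]) auto
      qed
      show "?R \<subseteq> ?L"
      proof
        fix x assume "x \<in> ?R"
        then obtain S R where "x = (S, R)" "(S, R, k) \<in> configs par n" by auto
        then show "x \<in> ?L" using config_realized[of S R k n] by blast
      qed
    qed
    moreover have "inj_on (\<lambda>c. (fst c, fst (snd c))) {c \<in> configs par n. snd (snd c) = k}"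
      by (auto simp: inj_on_def)
    ultimately show ?thesis unfolding card_P_set by (simp add: card_image)
  qed
  moreover have "monom (int (card {c \<in> configs par n. snd (snd c) = k})) k =
    (\<Sum>c | c \<in> configs par n \<and> snd (snd c) = k. monom 1 (snd (snd c)))" for k
    by (simp add: of_nat_poly smult_monom)
  ultimately have "p_poly {1..n} (simply_laced E) =
    (\<Sum>k\<le>n. \<Sum>c | c \<in> configs par n \<and> snd (snd c) = k. monom 1 (snd (snd c)))"
    by (simp add: p_poly_def)
  also have "\<dots> = (\<Sum>c\<in>configs par n. monom 1 (snd (snd c)))"
    using configs_bounds by (intro sum.group finite_configs) auto
  finally show ?thesis by (simp add: config_poly_def)
qed

end

section \<open>Types A and D\<close>

lemma abs_le_if_increments_le_1:
  fixes x :: "nat \<Rightarrow> int"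
  assumes "x 0 = 0" "\<And>j. 1 \<le> j \<Longrightarrow> j \<le> m \<Longrightarrow> \<bar>x j - x (j - 1)\<bar> \<le> 1" "k \<le> m"
  shows "\<bar>x k\<bar> \<le> int k"
  using assms(3)
proof (induction k)
  case (Suc k)
  then show ?case using assms(2)[of "Suc k"] by simp
qed (simp add: assms(1))

lemma abs_le_1_if_square_le_2: "\<bar>y\<bar> \<le> 1" if "y ^ 2 \<le> 2" for y :: int
proof (rule ccontr)
  assume "\<not> \<bar>y\<bar> \<le> 1"
  then have "2 ^ 2 \<le> \<bar>y\<bar> ^ 2" by (intro power_mono) auto
  with that show False by simp
qed

text \<open>Telescoping of 2a(a - b) = (a - b)^2 + a^2 - b^2 along the path.\<close>

lemma path_sum_of_squares:
  fixes x :: "nat \<Rightarrow> int"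
  assumes "x 0 = 0"
  shows "(\<Sum>j=1..m. 2 * x j * (x j - x (j - 1))) = (\<Sum>j=1..m. (x j - x (j - 1))\<^sup>2) + (x m)\<^sup>2"
proof (induction m)
  case (Suc m)
  then show ?case by (simp add: power2_eq_square algebra_simps)
qed (simp add: assms)

lemma increments_le_1:
  fixes x :: "nat \<Rightarrow> int"
  assumes "(\<Sum>j=1..m. (x j - x (j - 1))\<^sup>2) \<le> 2" "1 \<le> j" "j \<le> m"
  shows "\<bar>x j - x (j - 1)\<bar> \<le> 1"
proof (rule abs_le_1_if_square_le_2)
  have "(x j - x (j - 1))\<^sup>2 \<le> (\<Sum>j=1..m. (x j - x (j - 1))\<^sup>2)"
    using assms by (intro member_le_sum) auto
  then show "(x j - x (j - 1))\<^sup>2 \<le> 2" using assms(1) by linarith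
qed

lemma finite_forest_A: "finite_forest n (\<lambda>i j. j = i + 1) (\<lambda>j. j - 1)"
proof -
  interpret simply_laced_coxeter "{1..n}" "\<lambda>i j. j = i + 1" by unfold_locales simp
  interpret forest_coxeter n "\<lambda>i j. j = i + 1" "\<lambda>j. j - 1"
    by unfold_locales (unfold adj_def, auto)
  have bound: "\<bar>x k\<bar> \<le> int n"
    if x: "\<And>l. l \<notin> {1..n} \<Longrightarrow> x l = 0" "form x x = 2" and k: "k \<in> {1..n}" for x k
  proof -
    have "(\<Sum>j=1..n. (x j - x (j - 1))\<^sup>2) + (x n)\<^sup>2 = 2"
      using form_eq_par_sum[OF x(1)] x path_sum_of_squares[of x n] by simp
    then have "(\<Sum>j=1..n. (x j - x (j - 1))\<^sup>2) \<le> 2" using zero_le_power2[of "x n"] by linarith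
    from increments_le_1[OF this] have "\<bar>x k\<bar> \<le> int k"
      using k x(1)[of 0] by (intro abs_le_if_increments_le_1[of x n]) auto
    with k show ?thesis by simp
  qed
  show ?thesis by unfold_locales (rule finite_roots_if_bounded, rule bound)
qed

lemma finite_forest_D:
  assumes "3 \<le> n"
  shows "finite_forest n
    (\<lambda>i j. (j = i + 1 \<and> j + 2 \<le> n) \<or> (i + 2 = n \<and> (j + 1 = n \<or> j = n)))
    (\<lambda>j. if j = n then n - 2 else j - 1)"
    (is "finite_forest n ?E ?par")
proof -
  interpret simply_laced_coxeter "{1..n}" ?E by unfold_locales simp
  interpret forest_coxeter n ?E ?par
    using assms by unfold_locales (unfold adj_def, auto)
  have bound: "\<bar>x k\<bar> \<le> int n"
    if x: "\<And>l. l \<notin> {1..n} \<Longrightarrow> x l = 0" "form x x = 2" and k: "k \<in> {1..n}" for x k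
  proof -
    obtain m where n: "n = Suc (Suc m)" "1 \<le> m" using assms by (metis Suc_le_D Suc_le_mono numeral_3_eq_3 One_nat_def)
    have x0: "x 0 = 0" using x(1)[of 0] by simp
    have "(\<Sum>j=1..m. 2 * x j * (x j - x (?par j))) = (\<Sum>j=1..m. 2 * x j * (x j - x (j - 1)))"
      by (intro sum.cong) (auto simp: n)
    then have "2 = (\<Sum>j=1..m. (x j - x (j - 1))\<^sup>2) + (x m)\<^sup>2 + 2 * x (Suc m) * (x (Suc m) - x m)
      + 2 * x n * (x n - x m)"
      using form_eq_par_sum[OF x(1)] x(2) path_sum_of_squares[of x m, OF x0] by (simp add: n)
    \<comment> \<open>For the value a at the branch vertex and b, c at the two last leaves, a^2 +
      2b(b - a) + 2c(c - a) = (a - b - c)^2 + (b - c)^2, so the form is again a sum of integer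
      squares.\<close>
    then have sum: "2 = (\<Sum>j=1..m. (x j - x (j - 1))\<^sup>2) + (x m - x (Suc m) - x n)\<^sup>2 + (x (Suc m) - x n)\<^sup>2"
      by (simp add: power2_eq_square algebra_simps)
    have nonneg: "0 \<le> (\<Sum>j=1..m. (x j - x (j - 1))\<^sup>2)" by (intro sum_nonneg) simp
    have "(\<Sum>j=1..m. (x j - x (j - 1))\<^sup>2) \<le> 2" "(x m - x (Suc m) - x n)\<^sup>2 \<le> 2" "(x (Suc m) - x n)\<^sup>2 \<le> 2"
      using sum nonneg zero_le_power2[of "x m - x (Suc m) - x n"] zero_le_power2[of "x (Suc m) - x n"]
      by linarith+
    then have small: "\<bar>x l\<bar> \<le> int l" if "l \<le> m" for l
      using that x0 increments_le_1[of x m] by (intro abs_le_if_increments_le_1[of x m]) auto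
    have "\<bar>x m - x (Suc m) - x n\<bar> \<le> 1" "\<bar>x (Suc m) - x n\<bar> \<le> 1"
      by (intro abs_le_1_if_square_le_2; fact)+
    \<comment> \<open>Sum and difference of the two leaf values are within 1 of \<open>x m\<close>
      and of 0, so twice a leaf value is at most m + 2 = n in absolute value.\<close>
    with small[of m] have "\<bar>x (Suc m)\<bar> \<le> int n" "\<bar>x n\<bar> \<le> int n" by (simp_all add: n)
    then show ?thesis
      using k small[of k] by (cases "k \<le> m") (auto simp: n le_Suc_eq)
  qed
  show ?thesis by unfold_locales (rule finite_roots_if_bounded, rule bound)
qed

section \<open>Linear recurrences\<close>

lemma p_A_eq: "p_A n = config_poly (\<lambda>j. j - 1) n (\<lambda>_. True)"
  unfolding matrix_A_def by (rule finite_forest.p_poly_eq_config_poly[OF finite_forest_A])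

lemma config_poly_False [simp]: "config_poly par m (\<lambda>_. False) = 0"
  by (simp add: config_poly_def)

lemma path_config_poly_Suc:
  "config_poly (\<lambda>j. j - 1) (Suc m) Q = config_poly (\<lambda>j. j - 1) m Q
    + [:0, 1:] * config_poly (\<lambda>j. j - 1) m (\<lambda>S. m \<notin> S \<and> Q (insert (Suc m) S))
    + [:1, 2:] * config_poly (\<lambda>j. j - 1) m (\<lambda>S. m \<in> S \<and> Q (insert (Suc m) S))"
  by (subst config_poly_Suc) auto

lemma path_out_Suc: "config_poly (\<lambda>j. j - 1) (Suc m) (\<lambda>S. Suc m \<notin> S) = p_A m"
proof -
  have "config_poly (\<lambda>j. j - 1) m (\<lambda>S. Suc m \<notin> S) = p_A m"
    unfolding p_A_eq by (rule config_poly_cong) auto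
  then show ?thesis using path_config_poly_Suc[of m "\<lambda>S. Suc m \<notin> S"] by simp
qed

lemma path_in: "config_poly (\<lambda>j. j - 1) m (\<lambda>S. m \<in> S) =
    p_A m - config_poly (\<lambda>j. j - 1) m (\<lambda>S. m \<notin> S)"
  using config_poly_split[of "\<lambda>j. j - 1" m "\<lambda>S. m \<in> S" "\<lambda>_. True"] by (simp add: p_A_eq algebra_simps)

text \<open>The parent 0 of vertex 1 lies in no \<open>S\<close>; this is the starting value that
  \<open>path_out_Suc\<close> does not supply.\<close>

lemma path_out_0: "config_poly (\<lambda>j. j - 1) 0 (\<lambda>S. 0 \<notin> S) = 1"
  by (simp add: config_poly_def)

lemma p_A_0: "p_A 0 = 1"
  using p_A_eq[of 0] by (simp add: config_poly_def)

text \<open>With t and 1 + 2t written through the single indeterminate 1 + t, the identities below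
  become polynomial ones that \<open>algebra\<close> decides.\<close>

lemma X_eq_shift: "[:0, 1:] = [:1, 1:] - (1 :: int poly)"
  and affine_eq_shift: "[:1, 2:] = 2 * [:1, 1:] - (1 :: int poly)"
  by (simp_all add: numeral_poly one_pCons)

lemma p_A_Suc: "p_A (Suc m) = 2 * [:1, 1:] * p_A m - [:1, 1:] * config_poly (\<lambda>j. j - 1) m (\<lambda>S. m \<notin> S)"
proof -
  have "p_A (Suc m) = p_A m + [:0, 1:] * config_poly (\<lambda>j. j - 1) m (\<lambda>S. m \<notin> S)
    + [:1, 2:] * config_poly (\<lambda>j. j - 1) m (\<lambda>S. m \<in> S)"
    using path_config_poly_Suc[of m "\<lambda>_. True"] by (simp add: p_A_eq)
  then show ?thesis unfolding path_in X_eq_shift affine_eq_shift by algebra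
qed

lemma p_A_1: "p_A 1 = [:1, 1:]"
  using p_A_Suc[of 0] unfolding path_out_0 p_A_0 by (simp add: One_nat_def numeral_poly)

lemma p_A_rec: "p_A (m + 2) = 2 * [:1, 1:] * p_A (m + 1) - [:1, 1:] * p_A m"
proof -
  have "p_A (Suc (Suc m)) = 2 * [:1, 1:] * p_A (Suc m) - [:1, 1:] * p_A m"
    using p_A_Suc[of "Suc m"] unfolding path_out_Suc .
  then show ?thesis by (simp only: add_2_eq_Suc' Suc_eq_plus1)
qed

text \<open>Eliminating the intermediate terms from three consecutive instances of
  \<open>p_A_rec\<close> separates the parities; the factor 1 + 2t arises as 2(1 + t) - 1.\<close>

lemma p_A_rec2:
  "p_A (m + 4) = 2 * [:1, 1:] * [:1, 2:] * p_A (m + 2) - [:1, 1:]\<^sup>2 * p_A m"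
proof -
  have e: "m + 2 + 2 = m + 4" "m + 2 + 1 = m + 3" "m + 1 + 2 = m + 3" "m + 1 + 1 = m + 2" by simp_all
  show ?thesis
    using p_A_rec[of "m + 2"] p_A_rec[of "m + 1"] p_A_rec[of m] unfolding affine_eq_shift e by algebra
qed

text \<open>The two last vertices both hang on vertex \<open>m\<close>. Each contributes 1 + t if
  \<open>m\<close> is absent and 1 + (1 + 2t) = 2(1 + t) if it is present. The total is (1 + t)^2
  times \<open>?out + 4 * ?in\<close>, and \<open>?in = p_A m - ?out\<close> produces the
  coefficients 4 and -3.\<close>

lemma p_D_eq:
  assumes "1 \<le> m"
  shows "p_D (m + 2) = [:1, 1:]\<^sup>2 * (4 * p_A m - 3 * p_A (m - 1))"
proof -
  let ?n = "m + 2"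
  let ?par = "\<lambda>j. if j = ?n then ?n - 2 else j - 1"
  let ?path = "\<lambda>j. j - 1 :: nat"
  let ?out = "config_poly ?path m (\<lambda>S. m \<notin> S)"
  let ?in = "config_poly ?path m (\<lambda>S. m \<in> S)"
  have path: "config_poly ?par (Suc m) Q = config_poly ?path (Suc m) Q" for Q
    unfolding config_poly_def using configs_cong[of "Suc m" ?par ?path] by simp
  have next_in: "config_poly ?path m (\<lambda>S. m \<in> S \<and> m \<in> insert (Suc m) S) = ?in"
    "config_poly ?path m (\<lambda>S. m \<notin> S \<and> m \<in> insert (Suc m) S) = 0"
    by (simp_all cong: conj_cong)
  have next_out: "config_poly ?path m (\<lambda>S. m \<notin> S \<and> m \<notin> insert (Suc m) S) = ?out"
    "config_poly ?path m (\<lambda>S. m \<in> S \<and> m \<notin> insert (Suc m) S) = 0"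
    by (simp_all cong: conj_cong)
  have "p_D ?n = config_poly ?par (Suc (Suc m)) (\<lambda>_. True)"
    unfolding matrix_D_def
    using finite_forest.p_poly_eq_config_poly[OF finite_forest_D[of ?n]] assms by simp
  also have "\<dots> = config_poly ?par (Suc m) (\<lambda>_. True)
    + [:0, 1:] * config_poly ?par (Suc m) (\<lambda>S. m \<notin> S) + [:1, 2:] * config_poly ?par (Suc m) (\<lambda>S. m \<in> S)"
    by (subst config_poly_Suc) auto
  also have "\<dots> = p_A m + [:0, 1:] * ?out + [:1, 2:] * ?in
    + [:0, 1:] * (?out + [:0, 1:] * ?out) + [:1, 2:] * (?in + [:1, 2:] * ?in)"
    unfolding path path_config_poly_Suc next_in next_out by (simp add: p_A_eq)
  finally have "p_D ?n = p_A m + [:0, 1:] * ?out + [:1, 2:] * ?in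
    + [:0, 1:] * (?out + [:0, 1:] * ?out) + [:1, 2:] * (?in + [:1, 2:] * ?in)" .
  moreover have "?out = p_A (m - 1)" using path_out_Suc[of "m - 1"] assms by simp
  moreover have "?in = p_A m - ?out" by (rule path_in)
  ultimately show ?thesis unfolding X_eq_shift affine_eq_shift by algebra
qed

section \<open>Comparison with Chebyshev polynomials\<close>

lemma cheb_T_rec:
  "pcompose (cheb_T (Suc (Suc m))) p = 2 * p * pcompose (cheb_T (Suc m)) p - pcompose (cheb_T m) p"
  by (simp add: pcompose_pCons pcompose_smult pcompose_diff numeral_poly)

text \<open>Integer indices let the recurrence start at \<open>m = 0\<close>, where the convention
  for index -1 enters.\<close>

lemma cheb_U_rec:
  "pcompose (cheb_U (int m + 1)) p = 2 * p * pcompose (cheb_U (int m)) p - pcompose (cheb_U (int m - 1)) p"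
proof (cases m)
  case 0
  then show ?thesis by (simp add: cheb_U_def pcompose_pCons pcompose_1 numeral_poly)
next
  case (Suc k)
  then have "cheb_U (int m + 1) = cheb_U_nat (Suc (Suc k))" "cheb_U (int m) = cheb_U_nat (Suc k)"
    "cheb_U (int m - 1) = cheb_U_nat k"
    by (simp_all add: cheb_U_def nat_add_distrib del: cheb_U_nat.simps)
  then show ?thesis by (simp add: pcompose_pCons pcompose_smult pcompose_diff numeral_poly)
qed

text \<open>Division by \<open>q ^ m\<close> turns the recurrence of \<open>f\<close> into the
  Chebyshev recurrence at \<open>c\<close>. It is applied with q = 1 + t and c = 1 + 2t, and with q
  = 1 to compare two Chebyshev sequences.\<close>

lemma scaled_recurrence_unique:
  fixes f g :: "nat \<Rightarrow> 'a :: comm_ring_1"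
  assumes "f 0 = g 0" "f 1 = q * g 1"
    and "\<And>m. f (m + 2) = 2 * q * c * f (m + 1) - q\<^sup>2 * f m"
    and "\<And>m. g (m + 2) = 2 * c * g (m + 1) - g m"
  shows "f m = q ^ m * g m"
proof (induction m rule: induct_nat_012)
  case (ge2 m)
  then have IH: "f m = q ^ m * g m" "f (m + 1) = q ^ m * q * g (m + 1)" by (simp_all add: mult.commute flip: Suc_eq_plus1)
  have "f (m + 2) = q ^ (m + 2) * g (m + 2)"
    unfolding assms(3,4)[of m] IH by (simp add: power_add power2_eq_square algebra_simps)
  then show ?case by simp
qed (use assms(1,2) in \<open>simp_all add: One_nat_def\<close>)

lemma p_A_2: "p_A 2 = [:1, 1:] * [:1, 2:]"
  using p_A_rec[of 0] unfolding add_0 p_A_0 p_A_1 affine_eq_shift by algebra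

lemma p_A_3: "p_A 3 = [:1, 1:]\<^sup>2 * (2 * [:1, 2:] - 1)"
proof -
  have e: "1 + 2 = (3 :: nat)" "1 + 1 = (2 :: nat)" by simp_all
  show ?thesis using p_A_rec[of 1] unfolding e p_A_1 p_A_2 affine_eq_shift by algebra
qed

lemma p_A_rec_even:
    "p_A (2 * (m + 2)) = 2 * [:1, 1:] * [:1, 2:] * p_A (2 * (m + 1)) - [:1, 1:]\<^sup>2 * p_A (2 * m)"
  and p_A_rec_odd: "p_A (2 * (m + 2) + 1) =
    2 * [:1, 1:] * [:1, 2:] * p_A (2 * (m + 1) + 1) - [:1, 1:]\<^sup>2 * p_A (2 * m + 1)"
proof -
  have e: "2 * (m + 2) = 2 * m + 4" "2 * (m + 1) = 2 * m + 2"
    "2 * m + 4 + 1 = 2 * m + 1 + 4" "2 * m + 2 + 1 = 2 * m + 1 + 2" by simp_all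
  show "p_A (2 * (m + 2)) = 2 * [:1, 1:] * [:1, 2:] * p_A (2 * (m + 1)) - [:1, 1:]\<^sup>2 * p_A (2 * m)"
    unfolding e by (rule p_A_rec2)
  show "p_A (2 * (m + 2) + 1) =
    2 * [:1, 1:] * [:1, 2:] * p_A (2 * (m + 1) + 1) - [:1, 1:]\<^sup>2 * p_A (2 * m + 1)"
    unfolding e by (rule p_A_rec2)
qed

abbreviation T_poly :: "nat \<Rightarrow> int poly" where
  "T_poly m \<equiv> pcompose (cheb_T m) [:1, 2:]"

abbreviation U_poly :: "int \<Rightarrow> int poly" where
  "U_poly k \<equiv> pcompose (cheb_U k) [:1, 2:]"

lemma T_poly_rec: "T_poly (m + 2) = 2 * [:1, 2:] * T_poly (m + 1) - T_poly m"
  using cheb_T_rec[of m "[:1, 2:]"] by (simp only: add_2_eq_Suc' Suc_eq_plus1)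

lemma U_poly_rec: "U_poly (int m + 1) = 2 * [:1, 2:] * U_poly (int m) - U_poly (int m - 1)"
  by (rule cheb_U_rec)

lemma U_poly_rec2: "U_poly (int m + 2) = 2 * [:1, 2:] * U_poly (int m + 1) - U_poly (int m)"
  using cheb_U_rec[of "m + 1" "[:1, 2:]"] by (simp add: add.commute)

lemma T_poly_0: "T_poly 0 = 1" and T_poly_1: "T_poly 1 = [:1, 2:]"
  by (simp_all add: pcompose_1 pcompose_pCons One_nat_def)

lemma U_poly_neg: "U_poly (-1) = 0" and U_poly_0: "U_poly 0 = 1"
  by (simp_all add: cheb_U_def pcompose_1)

lemma U_poly_1: "U_poly 1 = 2 * [:1, 2:]"
  using U_poly_rec[of 0] by (simp add: U_poly_0 U_poly_neg)

lemma T_poly_2: "T_poly 2 = 2 * [:1, 2:] * [:1, 2:] - 1"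
  using T_poly_rec[of 0] unfolding add_0 T_poly_0 T_poly_1 .

lemma U_poly_2: "U_poly 2 = 2 * [:1, 2:] * (2 * [:1, 2:]) - 1"
  using U_poly_rec2[of 0] unfolding of_nat_0 add_0 U_poly_0 U_poly_1 .

lemma p_A_even: "p_A (2 * m) = [:1, 1:] ^ m * T_poly m"
proof (rule scaled_recurrence_unique[where c = "[:1, 2:]"])
  show "p_A (2 * 0) = T_poly 0" unfolding mult_0_right p_A_0 T_poly_0 ..
  show "p_A (2 * 1) = [:1, 1:] * T_poly 1" unfolding mult_1_right p_A_2 T_poly_1 ..
qed (rule p_A_rec_even T_poly_rec)+

lemma p_A_odd: "p_A (2 * m + 1) = [:1, 1:] ^ m * ([:1, 1:] * (U_poly (int m) - U_poly (int m - 1)))"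
proof (rule scaled_recurrence_unique[where c = "[:1, 2:]"])
  show "p_A (2 * 0 + 1) = [:1, 1:] * (U_poly (int 0) - U_poly (int 0 - 1))"
    using p_A_1 U_poly_0 U_poly_neg by simp
  have e: "2 * 1 + 1 = (3 :: nat)" "int 1 = 1" "1 - 1 = (0 :: int)" by simp_all
  show "p_A (2 * 1 + 1) = [:1, 1:] * ([:1, 1:] * (U_poly (int 1) - U_poly (int 1 - 1)))"
    unfolding e p_A_3 U_poly_0 U_poly_1 by algebra
  show "[:1, 1:] * (U_poly (int (m + 2)) - U_poly (int (m + 2) - 1)) =
    2 * [:1, 2:] * ([:1, 1:] * (U_poly (int (m + 1)) - U_poly (int (m + 1) - 1)))
    - [:1, 1:] * (U_poly (int m) - U_poly (int m - 1))" for m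
  proof -
    have e: "int (m + 2) = int m + 2" "int m + 2 - 1 = int m + 1" "int (m + 1) = int m + 1"
      "int m + 1 - 1 = int m" by simp_all
    show ?thesis unfolding e U_poly_rec2 U_poly_rec by algebra
  qed
qed (rule p_A_rec_odd)

text \<open>The even and odd subsequences of \<open>p_A\<close> obey the same recurrence, hence so
  does their combination, and agreement at \<open>m = 0\<close> and \<open>m = 1\<close> suffices.
  In this way the U values of \<open>p_A_odd\<close> need not be converted into T values.\<close>

lemma p_D_odd_rank: "4 * p_A (2 * m + 1) - 3 * p_A (2 * m) = [:1, 1:] ^ m * (2 * T_poly (m + 1) - T_poly m)"
proof (rule scaled_recurrence_unique[where c = "[:1, 2:]"])
  have "4 * [:1, 1:] - 3 * 1 = 2 * [:1, 2:] - (1 :: int poly)" unfolding affine_eq_shift by algebra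
  then show "4 * p_A (2 * 0 + 1) - 3 * p_A (2 * 0) = 2 * T_poly (0 + 1) - T_poly 0"
    unfolding mult_0_right add_0 p_A_0 p_A_1 T_poly_0 T_poly_1 .
  have e: "2 * 1 = (2 :: nat)" "2 + 1 = (3 :: nat)" "1 + 1 = (2 :: nat)" by simp_all
  show "4 * p_A (2 * 1 + 1) - 3 * p_A (2 * 1) = [:1, 1:] * (2 * T_poly (1 + 1) - T_poly 1)"
    unfolding e p_A_2 p_A_3 T_poly_1 T_poly_2 unfolding affine_eq_shift by algebra
  show "4 * p_A (2 * (m + 2) + 1) - 3 * p_A (2 * (m + 2)) =
    2 * [:1, 1:] * [:1, 2:] * (4 * p_A (2 * (m + 1) + 1) - 3 * p_A (2 * (m + 1)))
    - [:1, 1:]\<^sup>2 * (4 * p_A (2 * m + 1) - 3 * p_A (2 * m))" for m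
    unfolding p_A_rec_even p_A_rec_odd by algebra
  show "2 * T_poly (m + 2 + 1) - T_poly (m + 2) =
    2 * [:1, 2:] * (2 * T_poly (m + 1 + 1) - T_poly (m + 1)) - (2 * T_poly (m + 1) - T_poly m)" for m
  proof -
    have e: "m + 2 + 1 = m + 1 + 2" "m + 1 + 1 = m + 2" by simp_all
    show ?thesis unfolding e(1) unfolding T_poly_rec[of "m + 1"] unfolding e(2) T_poly_rec[of m] by algebra
  qed
qed

text \<open>Inserting the closed forms leaves one T value among U values; the identity 2 T_(m+1) =
  U_(m+1) - U_(m-1) removes it.\<close>

lemma p_D_even_rank: "4 * p_A (2 * (m + 1)) - 3 * p_A (2 * m + 1) =
  [:1, 1:] ^ m * ([:1, 1:] * (2 * U_poly (int m + 1) - 3 * U_poly (int m) + U_poly (int m - 1)))"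
proof -
  have "4 * p_A (2 * (m + 1)) - 3 * p_A (2 * m + 1) =
    [:1, 1:] ^ m * ([:1, 1:] * (4 * T_poly (m + 1) - 3 * (U_poly (int m) - U_poly (int m - 1))))"
    unfolding p_A_even p_A_odd by (simp only: power_add power_one_right) algebra
  moreover
  have T: "4 * T_poly (m + 1) = 2 * U_poly (int m + 1) - 2 * U_poly (int m - 1)"
  proof -
    \<comment> \<open>The factor \<open>1 ^ m\<close> gives the identity the shape of
      \<open>scaled_recurrence_unique\<close> with \<open>q = 1\<close>.\<close>
    have "2 * T_poly (m + 1) = 1 ^ m * (U_poly (int m + 1) - U_poly (int m - 1))"
    proof (rule scaled_recurrence_unique[where c = "[:1, 2:]"])
      show "2 * T_poly (0 + 1) = U_poly (int 0 + 1) - U_poly (int 0 - 1)"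
        using T_poly_1 U_poly_1 U_poly_neg by simp
      have e: "1 + 1 = (2 :: nat)" "int 1 + 1 = 2" "int 1 - 1 = 0" by simp_all
      show "2 * T_poly (1 + 1) = 1 * (U_poly (int 1 + 1) - U_poly (int 1 - 1))"
        unfolding e T_poly_2 U_poly_0 U_poly_2 by algebra
      show "2 * T_poly (m + 2 + 1) = 2 * 1 * [:1, 2:] * (2 * T_poly (m + 1 + 1)) - 1\<^sup>2 * (2 * T_poly (m + 1))" for m
      proof -
        have e: "m + 2 + 1 = m + 1 + 2" by simp
        show ?thesis unfolding e T_poly_rec[of "m + 1"] one_power2 mult_1_left mult_1_right by algebra
      qed
      show "U_poly (int (m + 2) + 1) - U_poly (int (m + 2) - 1) =
        2 * [:1, 2:] * (U_poly (int (m + 1) + 1) - U_poly (int (m + 1) - 1))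
        - (U_poly (int m + 1) - U_poly (int m - 1))" for m
      proof -
        have e: "int (m + 2) + 1 = int (m + 1) + 2" "int (m + 2) - 1 = int m + 1"
          "int (m + 1) + 1 = int m + 2" "int (m + 1) - 1 = int m" "int (m + 1) = int m + 1" by simp_all
        show ?thesis
          unfolding e(1) unfolding U_poly_rec2[of "m + 1"] unfolding e(2-4) unfolding e(5)
          unfolding U_poly_rec[of m] by algebra
      qed
    qed
    then show ?thesis by (simp add: algebra_simps)
  qed
  have "4 * T_poly (m + 1) - 3 * (U_poly (int m) - U_poly (int m - 1)) =
    2 * U_poly (int m + 1) - 3 * U_poly (int m) + U_poly (int m - 1)"
    unfolding T by algebra
  ultimately show ?thesis by (simp only:)
qed

theorem proposition3p76:
  "(\<forall>n::nat. p_A n = [:1, 1:] ^ nat \<lceil>real n / 2\<rceil> *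
      (if even n
       then pcompose (cheb_T (n div 2)) [:1, 2:]
       else pcompose (cheb_U \<lfloor>real n / 2\<rfloor>) [:1, 2:]
            - pcompose (cheb_U (\<lfloor>real n / 2\<rfloor> - 1)) [:1, 2:]))
   \<and>
   (\<forall>n::nat. n \<ge> 2 \<longrightarrow> p_D (n + 1) = [:1, 1:] ^ (nat \<lceil>real n / 2\<rceil> + 1) *
      (if even n
       then 2 * pcompose (cheb_T (n div 2)) [:1, 2:]
            - pcompose (cheb_T (n div 2 - 1)) [:1, 2:]
       else 2 * pcompose (cheb_U \<lfloor>real n / 2\<rfloor>) [:1, 2:]
            - 3 * pcompose (cheb_U (\<lfloor>real n / 2\<rfloor> - 1)) [:1, 2:]
            + pcompose (cheb_U (\<lfloor>real n / 2\<rfloor> - 2)) [:1, 2:]))"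
proof (intro conjI allI impI)
  have ceil_even: "nat \<lceil>real (2 * m) / 2\<rceil> = m" for m by simp
  have ceil_odd: "nat \<lceil>real (2 * m + 1) / 2\<rceil> = m + 1" and floor_odd: "\<lfloor>real (2 * m + 1) / 2\<rfloor> = int m" for m
  proof -
    show "\<lfloor>real (2 * m + 1) / 2\<rfloor> = int m" by (rule floor_unique) (simp_all add: field_simps)
    have "\<lceil>real (2 * m + 1) / 2\<rceil> = int m + 1" by (rule ceiling_unique) (simp_all add: field_simps)
    then show "nat \<lceil>real (2 * m + 1) / 2\<rceil> = m + 1" by simp
  qed
  fix n :: nat
  show "p_A n = [:1, 1:] ^ nat \<lceil>real n / 2\<rceil> *
      (if even n then T_poly (n div 2)
       else U_poly \<lfloor>real n / 2\<rfloor> - U_poly (\<lfloor>real n / 2\<rfloor> - 1))"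
  proof (cases "even n")
    case True
    then obtain m where n: "n = 2 * m" by (rule evenE)
    then have "n div 2 = m" by simp
    then show ?thesis using True unfolding n ceil_even p_A_even by simp
  next
    case False
    then obtain m where n: "n = 2 * m + 1" by (rule oddE)
    have "p_A (2 * m + 1) = [:1, 1:] ^ (m + 1) * (U_poly (int m) - U_poly (int m - 1))"
      unfolding p_A_odd power_add power_one_right by (simp only: mult.assoc)
    then show ?thesis using False unfolding n ceil_odd floor_odd by (simp only: if_False)
  qed
  assume "2 \<le> n"
  show "p_D (n + 1) = [:1, 1:] ^ (nat \<lceil>real n / 2\<rceil> + 1) *
      (if even n then 2 * T_poly (n div 2) - T_poly (n div 2 - 1)
       else 2 * U_poly \<lfloor>real n / 2\<rfloor> - 3 * U_poly (\<lfloor>real n / 2\<rfloor> - 1) + U_poly (\<lfloor>real n / 2\<rfloor> - 2))"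
  proof (cases "even n")
    case True
    then obtain k where "n = 2 * k" by (rule evenE)
    with \<open>2 \<le> n\<close> obtain m where n: "n = 2 * (m + 1)" by (cases k) auto
    have e: "2 * (m + 1) + 1 = 2 * m + 1 + 2" "2 * m + 1 - 1 = 2 * m" "2 * (m + 1) div 2 = m + 1" "m + 1 - 1 = m"
      by simp_all
    have "p_D (2 * m + 1 + 2) = [:1, 1:]\<^sup>2 * (4 * p_A (2 * m + 1) - 3 * p_A (2 * m))"
      using p_D_eq[of "2 * m + 1"] by simp
    also have "\<dots> = [:1, 1:] ^ (m + 1 + 1) * (2 * T_poly (m + 1) - T_poly m)"
      unfolding p_D_odd_rank power_add power_one_right by algebra
    finally show ?thesis using True unfolding n ceil_even e by (simp only: if_True)
  next
    case False
    then obtain k where "n = 2 * k + 1" by (rule oddE)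
    with \<open>2 \<le> n\<close> obtain m where n: "n = 2 * (m + 1) + 1" by (cases k) auto
    \<comment> \<open>The indices of U become m + 1, m and m - 1, so none falls below -1, the least
      index at which \<open>cheb_U\<close> has a meaning.\<close>
    have e: "2 * (m + 1) + 1 + 1 = 2 * (m + 1) + 2" "int (m + 1) = int m + 1" "int m + 1 - 1 = int m"
      "int m + 1 - 2 = int m - 1" "2 * (m + 1) - 1 = 2 * m + 1" by simp_all
    have "p_D (2 * (m + 1) + 2) = [:1, 1:]\<^sup>2 * (4 * p_A (2 * (m + 1)) - 3 * p_A (2 * m + 1))"
      using p_D_eq[of "2 * (m + 1)"] unfolding e(5) by simp
    also have "\<dots> = [:1, 1:] ^ (m + 1 + 1 + 1) *
      (2 * U_poly (int m + 1) - 3 * U_poly (int m) + U_poly (int m - 1))"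
      unfolding p_D_even_rank power_add power_one_right by algebra
    finally show ?thesis using False unfolding n ceil_odd floor_odd e by (simp only: if_False)
  qed
qed

end
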